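(* Let $v\in\mathbf{A}^{2\times n}$ have a uniform matroid of rank $2$. The $K$-polynomial of $X_v$ is $$\mathcal{K}(X_v;u,t)=1-\sum_{\substack{\lambda=(\lambda_1\ge\lambda_2)\\ 2\le\lambda_2,\ \lambda_1+\lambda_2\le n}}(-1)^{|\lambda|}\,s_\lambda(1,1)\,s_\lambda(u_1,u_2)\,e_{|\lambda|}(t_1,\dots,t_n).$$
   Context: $\mathbf{k}$ is an algebraically closed field of characteristic zero. With $r=2$, let $R=\mathbf{k}[x_{ij}:1\le i\le r,\ 1\le j\le n]$ and $\mathbf{A}^{r\times n}=\operatorname{Spec} R$. The matroid of $v$ is uniform of rank $2$ if every pair of columns of $v$ is linearly independent (and $n\ge2$). $X_v$ is the Zariski closure of the orbit of $v$ under $G=\mathrm{GL}_r(\mathbf{k})\times(\mathbf{k}^\times)^n$, acting by left multiplication and rescaling of columns. $R$ is graded by $\mathbb{Z}^r\times\mathbb{Z}^n$ with $\deg x_{ij}=a_i+b_j$, where $a_1,\dots,a_r,b_1,\dots,b_n$ are the standard basis vectors. For a finitely generated graded $R$-module $M$, $\operatorname{Hilb}(M)=\sum_{(\mathbf{a},\mathbf{b})}\dim_{\mathbf{k}}(M_{(\mathbf{a},\mathbf{b})})u^{\mathbf{a}}t^{\mathbf{b}}$, and the $K$-polynomial $\mathcal{K}(M;u,t)$ is the Laurent polynomial with $\operatorname{Hilb}(M)=\mathcal{K}(M;u,t)/\prod_{i=1}^r\prod_{j=1}^n(1-u_it_j)$. For a closed subvariety $X$ with ideal $I$, $\mathcal{K}(X)=\mathcal{K}(R/I)$.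 $s_\lambda$ denotes Schur polynomials and $e_k$ elementary symmetric polynomials. *)

theory Defs
  imports "HOL-Analysis.Determinants" "HOL-Library.Poly_Mapping" "HOL-Library.FuncSet"
    "HOL-Computational_Algebra.Polynomial"
begin

section \<open>The polynomial ring of the space of matrices\<close>

text \<open>
  A point of $\mathbf{A}^{r\times n}$ is a matrix of type \<open>'k^'n^'r\<close> (rows indexed by \<open>'r\<close>,
  columns by \<open>'n\<close>).  The ring $R = \mathbf{k}[x_{ij}]$ is the monoid algebra of the
  exponent vectors \<open>('r \<times> 'n) \<Rightarrow>\<^sub>0 nat\<close>.
\<close>

type_synonym ('r, 'n) monom = "('r \<times> 'n) \<Rightarrow>\<^sub>0 nat"
type_synonym ('k, 'r, 'n) mat_poly = "('r, 'n) monom \<Rightarrow>\<^sub>0 'k"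

definition eval_mat :: "('k::comm_ring_1)^'n::finite^'r::finite \<Rightarrow> ('k, 'r, 'n) mat_poly \<Rightarrow> 'k" where
  "eval_mat w f = (\<Sum>m\<in>Poly_Mapping.keys f. Poly_Mapping.lookup f m *
      (\<Prod>i\<in>UNIV. \<Prod>j\<in>UNIV. (w $ i $ j) ^ Poly_Mapping.lookup m (i, j)))"

definition vanishing_ideal :: "(('k::comm_ring_1)^'n::finite^'r::finite) set \<Rightarrow> ('k, 'r, 'n) mat_poly set" where
  "vanishing_ideal X = {f. \<forall>w\<in>X. eval_mat w f = 0}"

definition zero_locus :: "('k::comm_ring_1, 'r::finite, 'n::finite) mat_poly set \<Rightarrow> ('k^'n^'r) set" where
  "zero_locus F = {w. \<forall>f\<in>F. eval_mat w f = 0}"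

definition zariski_closed :: "(('k::comm_ring_1)^'n::finite^'r::finite) set \<Rightarrow> bool" where
  "zariski_closed Z \<longleftrightarrow> (\<exists>F. Z = zero_locus F)"

definition zariski_closure :: "(('k::comm_ring_1)^'n::finite^'r::finite) set \<Rightarrow> ('k^'n^'r) set" where
  "zariski_closure Y = \<Inter> {Z. zariski_closed Z \<and> Y \<subseteq> Z}"

section \<open>Matrix orbit closures\<close>

definition matrix_orbit :: "('k::field)^'n::finite^'r::finite \<Rightarrow> ('k^'n^'r) set" where
  "matrix_orbit v = {(\<chi> i j. (g ** v) $ i $ j * d j) | (g :: 'k^'r^'r) (d :: 'n \<Rightarrow> 'k).
      invertible g \<and> (\<forall>j. d j \<noteq> 0)}"

definition matrix_orbit_closure :: "('k::field)^'n::finite^'r::finite \<Rightarrow> ('k^'n^'r) set" where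
  "matrix_orbit_closure v = zariski_closure (matrix_orbit v)"

text \<open>
  The inequality of the two columns is stated separately because \<open>vec.independent\<close> is about
  sets: two equal nonzero columns would form an independent singleton.
\<close>

definition uniform_rank2 :: "('k::field)^'n::finite^2 \<Rightarrow> bool" where
  "uniform_rank2 v \<longleftrightarrow> CARD('n) \<ge> 2 \<and>
     (\<forall>j l. j \<noteq> l \<longrightarrow>
        column j v \<noteq> column l v \<and> vec.independent {column j v, column l v})"

section \<open>Multigraded Hilbert series and K-polynomials\<close>

text \<open>
  The grading group $\mathbb{Z}^r\times\mathbb{Z}^n$ is \<open>(int^'r) \<times> (int^'n)\<close>; its integral group
  ring is the ring of Laurent polynomials in $u$ and $t$.
\<close>

type_synonym ('r, 'n) mdeg = "(int^'r) \<times> (int^'n)"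
type_synonym ('r, 'n) laurent = "('r, 'n) mdeg \<Rightarrow>\<^sub>0 int"

definition u_var :: "'r::finite \<Rightarrow> ('r, 'n::finite) laurent" where
  "u_var i = Poly_Mapping.single (axis i 1, 0) 1"

definition t_var :: "'n::finite \<Rightarrow> ('r::finite, 'n) laurent" where
  "t_var j = Poly_Mapping.single (0, axis j 1) 1"

definition monom_deg :: "('r::finite, 'n::finite) monom \<Rightarrow> ('r, 'n) mdeg" where
  "monom_deg m = ((\<chi> i. \<Sum>j\<in>UNIV. int (Poly_Mapping.lookup m (i, j))),
                  (\<chi> j. \<Sum>i\<in>UNIV. int (Poly_Mapping.lookup m (i, j))))"

definition graded_piece :: "('r::finite, 'n::finite) mdeg \<Rightarrow> ('k::field, 'r, 'n) mat_poly set" where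
  "graded_piece d = {f. \<forall>m\<in>Poly_Mapping.keys f. monom_deg m = d}"

text \<open>
  The degree \<open>d\<close> piece of $R/I$ is the image of $R_d$.  A set \<open>B \<subseteq> graded_piece d\<close> satisfies
  \<open>quotient_basis I d B\<close> iff \<open>b \<mapsto> b + I\<close> maps it bijectively onto a basis of $(R/I)_d$:
  the first clause after \<open>finite B\<close> is linear independence in $R/I$, the second is spanning.
\<close>

definition quotient_basis ::
  "('k::field, 'r::finite, 'n::finite) mat_poly set \<Rightarrow> ('r, 'n) mdeg \<Rightarrow> ('k, 'r, 'n) mat_poly set \<Rightarrow> bool" where
  "quotient_basis I d B \<longleftrightarrow> B \<subseteq> graded_piece d \<and> finite B \<and>
     (\<forall>c. (\<Sum>b\<in>B. Poly_Mapping.single 0 (c b) * b) \<in> I \<longrightarrow> (\<forall>b\<in>B. c b = 0)) \<and>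
     (\<forall>f\<in>graded_piece d. \<exists>c. f - (\<Sum>b\<in>B. Poly_Mapping.single 0 (c b) * b) \<in> I)"

definition hilbert_function ::
  "('k::field, 'r::finite, 'n::finite) mat_poly set \<Rightarrow> ('r, 'n) mdeg \<Rightarrow> nat" where
  "hilbert_function I d = (THE k. \<exists>B. quotient_basis I d B \<and> card B = k)"

text \<open>
  Formal series indexed by the whole grading group form a module over the Laurent polynomials.
\<close>

definition laurent_times_series ::
  "('r::finite, 'n::finite) laurent \<Rightarrow> (('r, 'n) mdeg \<Rightarrow> int) \<Rightarrow> (('r, 'n) mdeg \<Rightarrow> int)" where
  "laurent_times_series P H d =
     (\<Sum>e\<in>Poly_Mapping.keys P. Poly_Mapping.lookup P e * H (d - e))"

text \<open>
  The K-polynomial of $R/I$: the Laurent polynomial $K$ with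
  $\mathrm{Hilb}(R/I)\cdot\prod_{i,j}(1-u_it_j) = K$.
\<close>

definition K_polynomial :: "('k::field, 'r::finite, 'n::finite) mat_poly set \<Rightarrow> ('r, 'n) laurent" where
  "K_polynomial I = (THE K. \<forall>d. Poly_Mapping.lookup K d =
     laurent_times_series (\<Prod>i\<in>UNIV. \<Prod>j\<in>UNIV. 1 - u_var i * t_var j)
       (\<lambda>d. int (hilbert_function I d)) d)"

definition K_polynomial_variety :: "(('k::field)^'n::finite^'r::finite) set \<Rightarrow> ('r, 'n) laurent" where
  "K_polynomial_variety X = K_polynomial (vanishing_ideal X)"

section \<open>Symmetric polynomials\<close>

definition young_cells :: "nat list \<Rightarrow> (nat \<times> nat) set" where
  "young_cells la = {(p, q). p < length la \<and> q < la ! p}"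

definition ssyt :: "nat list \<Rightarrow> nat \<Rightarrow> (nat \<times> nat \<Rightarrow> nat) set" where
  "ssyt la m = {T \<in> young_cells la \<rightarrow>\<^sub>E {..<m}.
     (\<forall>p q. (p, Suc q) \<in> young_cells la \<longrightarrow> T (p, q) \<le> T (p, Suc q)) \<and>
     (\<forall>p q. (Suc p, q) \<in> young_cells la \<longrightarrow> T (p, q) < T (Suc p, q))}"

text \<open>
  The Schur polynomial of the partition \<open>la\<close> (weakly decreasing parts) in \<open>length xs\<close>
  variables, evaluated at \<open>xs\<close>.  Tableau entries and cells are counted from \<open>0\<close>.
\<close>

definition schur :: "nat list \<Rightarrow> 'a::comm_ring_1 list \<Rightarrow> 'a" where
  "schur la xs = (\<Sum>T\<in>ssyt la (length xs). \<Prod>z\<in>young_cells la. xs ! T z)"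

definition elem_sym :: "nat \<Rightarrow> ('n::finite \<Rightarrow> 'a::comm_ring_1) \<Rightarrow> 'a" where
  "elem_sym k x = (\<Sum>S | card S = k. \<Prod>j\<in>S. x j)"

end

theory Submission
  imports Defs "HOL-Library.Function_Algebras"
begin

text \<open>
  Write $\ell_j$ for the linear form on the plane given by the \<open>j\<close>-th column of \<open>v\<close>, and
  let $g \in \mathrm{GL}_2$ have rows $g_1, g_2$. A polynomial of degree $(a, b)$ vanishes on the orbit
  iff it vanishes at \<open>g ** v\<close> for all invertible \<open>g\<close>, because rescaling a column multiplies
  its value by a nonzero factor. So the piece of degree $(a, b)$ of the coordinate ring is the space
  spanned by the functions $\prod_j \ell_j(g_1)^{p_j} \ell_j(g_2)^{r_j}$ with $p + r = b$,
  $\sum_j p_j = a_1$ and $\sum_j r_j = a_2$.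

  This space is filtered by powers of \<open>det g\<close>. Moving one factor $\ell_i$ from $g_1$ to $g_2$
  and one factor $\ell_j$ back changes a product by $[ij] \det g$ times a product with these two
  factors removed, where $[ij] \neq 0$ is a minor of \<open>v\<close>. Hence, modulo $\det g$, a product only
  depends on $q = p + r$ and is the polarisation of the binary form $\prod_j \ell_j^{q_j}$. After \<open>k\<close>
  steps the exponents \<open>q\<close> that occur are those with $b_j - k \le q_j \le b_j$ and
  $\sum_j q_j = \sum_j b_j - 2k$. All these forms are divisible by $\prod_j \ell_j^{\max(0, b_j - k)}$,
  and since no $\ell_j$ occurs more than \<open>k\<close> times in what remains, they span all
  multiples of that product in their degree (lemma \<open>line_products_basis\<close>). This gives layer \<open>k\<close> the dimension
  $\max(0, 1 - 2k + \sum_j \min(b_j, k))$, independently of \<open>v\<close>. Polarisation is linear and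
  has a left inverse, the restriction to $g_1 = g_2$, so the layers add up (lemma
  \<open>layer_dim_step\<close>) and, for $a_1 + a_2 = \sum_j b_j$,

  $H(a, b) = \sum_{k=0}^{\min(a_1, a_2)} \max(0, 1 - 2k + \sum_j \min(b_j, k))$
  (theorem \<open>hilbert_function_orbit_closure\<close>).

  It remains to sum this series. Multiplying it by $u_1 - u_2$ turns the sum over \<open>k\<close> into the
  difference of its terms at $a_2$ and at $a_1$, and the truncation $\max(0, \cdot)$ can then be
  replaced by a linear correction (lemma \<open>dim_profile_reflection\<close>). Two further factors
  $u_1 - u_2$ take second differences of piecewise linear functions of \<open>k\<close>, which leaves a
  combination of geometric series (lemma \<open>orbit_series_closed_form\<close>). Multiplied by
  $\prod_{i,j} (1 - u_i t_j)$ it becomes a Laurent polynomial with coefficients symmetric in the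
  $t_j$. On the other side $(u_1 - u_2)\, s_\lambda(u_1, u_2)$ is an alternant, so
  $(u_1 - u_2)^3$ times the claimed sum telescopes to the same polynomial (lemma
  \<open>schur_K_numerator\<close>). The factor $(u_1 - u_2)^3$ can be cancelled because all series involved
  have exponents bounded below.
\<close>

section \<open>Bases of univariate polynomials made of linear factors\<close>

text \<open>
  Let \<open>L 0, L 1, \<dots>\<close> be a list of linear factors in which equal factors are less than \<open>k\<close>
  places apart, and \<open>M t = L (t + k)\<close>. Then \<open>window_prod L M e i\<close> is the product of the first \<open>e + k\<close>
  factors with a window of \<open>k\<close> consecutive ones left out, starting at place \<open>i\<close>.
\<close>

definition window_prod :: "(nat \<Rightarrow> 'a::comm_monoid_mult) \<Rightarrow> (nat \<Rightarrow> 'a) \<Rightarrow> nat \<Rightarrow> nat \<Rightarrow> 'a" where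
  "window_prod L M e i = (\<Prod>t<i. L t) * (\<Prod>t\<in>{i..<e}. M t)"

lemma window_prod_Suc: "i \<le> e \<Longrightarrow> window_prod L M (Suc e) i = window_prod L M e i * M e"
  by (simp add: window_prod_def mult.assoc)

lemma window_prod_full: "window_prod L M e e = (\<Prod>t<e. L t)"
  by (simp add: window_prod_def)

text \<open>
  At the root of the last \<open>M\<close> all products vanish except the one without any \<open>M\<close>, so the
  coefficient of that one is zero; the others have the last \<open>M\<close> as a common factor, which can be
  divided out.
\<close>

lemma window_prods_independent:
  fixes L M :: "nat \<Rightarrow> 'k::field poly"
  assumes "\<And>t. t < e \<Longrightarrow> M t \<noteq> 0 \<and> poly (M t) (\<rho> t) = 0"
    and "\<And>s t. s \<le> t \<Longrightarrow> t < e \<Longrightarrow> poly (L s) (\<rho> t) \<noteq> 0"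
    and "(\<Sum>i\<le>e. smult (c i) (window_prod L M e i)) = 0"
  shows "\<forall>i\<le>e. c i = 0"
  using assms
proof (induction e)
  case 0
  then show ?case by (simp add: window_prod_def)
next
  case (Suc e)
  let ?S = "\<Sum>i\<le>e. smult (c i) (window_prod L M e i)"
  have split: "(\<Sum>i\<le>Suc e. smult (c i) (window_prod L M (Suc e) i))
      = ?S * M e + smult (c (Suc e)) (\<Prod>t<Suc e. L t)"
    by (simp add: window_prod_Suc window_prod_full sum_distrib_right del: prod.lessThan_Suc)
  have "poly (?S * M e + smult (c (Suc e)) (\<Prod>t<Suc e. L t)) (\<rho> e) = 0"
    using Suc.prems(3) unfolding split by simp
  then have "c (Suc e) * (\<Prod>t<Suc e. poly (L t) (\<rho> e)) = 0"
    using Suc.prems(1)[of e] by (simp add: poly_prod del: prod.lessThan_Suc)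
  moreover have "(\<Prod>t<Suc e. poly (L t) (\<rho> e)) \<noteq> 0"
    using Suc.prems(2)[of _ e] by (simp add: less_Suc_eq_le del: prod.lessThan_Suc)
  ultimately have c: "c (Suc e) = 0" by simp
  then have "?S * M e = 0" using Suc.prems(3) unfolding split by simp
  then have "?S = 0" using Suc.prems(1)[of e] by simp
  then have "\<forall>i\<le>e. c i = 0" using Suc.prems by (intro Suc.IH) auto
  then show ?case using c by (simp add: le_Suc_eq)
qed

lemma smult_sum_right: "smult c (\<Sum>i\<in>A. f i) = (\<Sum>i\<in>A. smult c (f i))"
  by (induction A rule: infinite_finite_induct) (simp_all add: smult_add_right)

text \<open>
  A multiple of the product without any \<open>M\<close> corrects the value of \<open>F\<close> at the root of the last \<open>M\<close>
  to zero, and then the last \<open>M\<close> can be divided out.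
\<close>

lemma window_prods_span:
  fixes L M :: "nat \<Rightarrow> 'k::field poly"
  assumes "\<And>t. t < e \<Longrightarrow> degree (M t) = 1 \<and> poly (M t) (\<rho> t) = 0"
    and "\<And>s t. s \<le> t \<Longrightarrow> t < e \<Longrightarrow> poly (L s) (\<rho> t) \<noteq> 0"
    and "\<And>t. t < e \<Longrightarrow> degree (L t) \<le> 1"
    and "degree F \<le> e"
  shows "\<exists>c. F = (\<Sum>i\<le>e. smult (c i) (window_prod L M e i))"
  using assms
proof (induction e arbitrary: F)
  case 0
  then have "F = [:coeff F 0:]" using degree_eq_zeroE[of F] by force
  then show ?case by (intro exI[of _ "\<lambda>_. coeff F 0"]) (simp add: window_prod_def one_pCons)
next
  case (Suc e)
  let ?A = "\<Prod>t<Suc e. L t"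
  have A: "poly ?A (\<rho> e) \<noteq> 0"
    using Suc.prems(2)[of _ e] by (simp add: poly_prod less_Suc_eq_le del: prod.lessThan_Suc)
  define x where "x = poly F (\<rho> e) / poly ?A (\<rho> e)"
  have "poly (F - smult x ?A) (\<rho> e) = 0" using A by (simp add: x_def)
  then obtain F1 where F1: "F - smult x ?A = [:- \<rho> e, 1:] * F1"
    unfolding poly_eq_0_iff_dvd by (elim dvdE)
  have Me: "degree (M e) = 1" "poly (M e) (\<rho> e) = 0" using Suc.prems(1)[of e] by auto
  then obtain w0 where w0: "M e = [:- \<rho> e, 1:] * w0"
    unfolding poly_eq_0_iff_dvd by (elim dvdE)
  have "w0 \<noteq> 0" using w0 Me(1) by auto
  then have "degree w0 = 0" using Me(1) unfolding w0 by (subst (asm) degree_mult_eq) auto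
  then obtain w where w: "w0 = [:w:]" by (auto elim: degree_eq_zeroE)
  with \<open>w0 \<noteq> 0\<close> have wn: "w \<noteq> 0" by simp
  have degA: "degree ?A \<le> Suc e"
  proof -
    have "degree ?A \<le> (\<Sum>t<Suc e. degree (L t))"
      by (rule order.trans[OF degree_prod_sum_le]) (auto simp: comp_def)
    also have "\<dots> \<le> (\<Sum>t<Suc e. 1)" using Suc.prems(3) by (intro sum_mono) auto
    finally show ?thesis by simp
  qed
  have "degree (F - smult x ?A) \<le> Suc e"
    using degA Suc.prems(4) by (intro degree_diff_le order.trans[OF degree_smult_le])
  then have dF1: "degree F1 \<le> e"
    unfolding F1 by (cases "F1 = 0") (auto simp: degree_mult_eq simp del: mult_pCons_left)
  have "\<exists>c. F1 = (\<Sum>i\<le>e. smult (c i) (window_prod L M e i))"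
    using dF1 Suc.prems by (intro Suc.IH) auto
  then obtain c where c: "F1 = (\<Sum>i\<le>e. smult (c i) (window_prod L M e i))" by blast
  define c' where "c' i = (if i \<le> e then c i / w else x)" for i
  have "F = [:- \<rho> e, 1:] * F1 + smult x ?A" using F1 by (simp add: algebra_simps)
  also have "[:- \<rho> e, 1:] * F1 = M e * smult (1 / w) F1"
    unfolding w0 w using wn by (simp add: mult.commute)
  also have "\<dots> = (\<Sum>i\<le>e. smult (c' i) (window_prod L M (Suc e) i))"
    unfolding c smult_sum_right sum_distrib_left
    by (intro sum.cong) (auto simp: c'_def window_prod_Suc mult.commute)
  also have "\<dots> + smult x ?A = (\<Sum>i\<le>Suc e. smult (c' i) (window_prod L M (Suc e) i))"
    by (simp add: c'_def window_prod_full del: prod.lessThan_Suc)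
  finally show ?case by blast
qed

text \<open>
  List the elements of \<open>J\<close> with multiplicities \<open>\<beta>\<close> so that equal ones are adjacent. The last
  clause says that equal elements lie close together; it makes factors that are far apart in the list
  coprime.
\<close>

lemma blockwise_enumeration:
  fixes \<beta> :: "'n \<Rightarrow> nat"
  assumes "finite J"
  shows "\<exists>\<sigma>. (\<forall>t < sum \<beta> J. \<sigma> t \<in> J) \<and> (\<forall>j\<in>J. card {t. t < sum \<beta> J \<and> \<sigma> t = j} = \<beta> j) \<and>
     (\<forall>s t. s < t \<longrightarrow> t < sum \<beta> J \<longrightarrow> \<sigma> s = \<sigma> t \<longrightarrow> t - s < \<beta> (\<sigma> t))"
  using assms
proof (induction J rule: finite_induct)
  case empty
  then show ?case by simp
next
  case (insert j J)
  let ?s = "sum \<beta> J"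
  obtain \<sigma> where \<sigma>: "\<And>t. t < ?s \<Longrightarrow> \<sigma> t \<in> J" "\<And>i. i \<in> J \<Longrightarrow> card {t. t < ?s \<and> \<sigma> t = i} = \<beta> i"
    "\<And>s t. s < t \<Longrightarrow> t < ?s \<Longrightarrow> \<sigma> s = \<sigma> t \<Longrightarrow> t - s < \<beta> (\<sigma> t)"
    using insert.IH by blast
  define \<tau> where "\<tau> t = (if t < ?s then \<sigma> t else j)" for t
  have sum: "sum \<beta> (insert j J) = ?s + \<beta> j" using insert.hyps by (simp add: add.commute)
  have jJ: "j \<notin> J" by fact
  have "card {t. t < ?s + \<beta> j \<and> \<tau> t = j} = \<beta> j"
  proof -
    have "{t. t < ?s + \<beta> j \<and> \<tau> t = j} = {?s..<?s + \<beta> j}" 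
    proof (intro set_eqI iffI)
      fix t assume "t \<in> {t. t < ?s + \<beta> j \<and> \<tau> t = j}"
      then show "t \<in> {?s..<?s + \<beta> j}" using \<sigma>(1)[of t] jJ by (cases "t < ?s") (auto simp: \<tau>_def)
    qed (auto simp: \<tau>_def)
    then show ?thesis by simp
  qed
  moreover have "card {t. t < ?s + \<beta> j \<and> \<tau> t = i} = \<beta> i" if "i \<in> J" for i
  proof -
    have "{t. t < ?s + \<beta> j \<and> \<tau> t = i} = {t. t < ?s \<and> \<sigma> t = i}" using that jJ by (auto simp: \<tau>_def)
    then show ?thesis using \<sigma>(2)[OF that] by simp
  qed
  moreover have "t - s < \<beta> (\<tau> t)" if "s < t" "t < ?s + \<beta> j" "\<tau> s = \<tau> t" for s t
  proof (cases "t < ?s")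
    case True
    then show ?thesis using that \<sigma>(3)[of s t] by (simp add: \<tau>_def)
  next
    case False
    then have "\<not> s < ?s" using that \<sigma>(1)[of s] jJ by (auto simp: \<tau>_def)
    then show ?thesis using that False by (simp add: \<tau>_def)
  qed
  moreover have "\<tau> t \<in> insert j J" for t using \<sigma>(1) by (auto simp: \<tau>_def)
  ultimately show ?case unfolding sum by (intro exI[of _ \<tau>]) auto
qed

lemma sum_card_fibres:
  fixes \<sigma> :: "nat \<Rightarrow> 'n::finite"
  assumes "finite T"
  shows "(\<Sum>j\<in>UNIV. card {t\<in>T. \<sigma> t = j}) = card T"
proof -
  have "(\<Sum>j\<in>UNIV. sum (\<lambda>t. 1) {t\<in>T. \<sigma> t = j}) = (\<Sum>t\<in>T. 1::nat)"
    by (rule sum.group) (use assms in auto)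
  then show ?thesis by simp
qed

lemma prod_card_fibres:
  fixes \<sigma> :: "nat \<Rightarrow> 'n::finite" and f :: "'n \<Rightarrow> 'a::comm_monoid_mult"
  assumes "finite T"
  shows "(\<Prod>j\<in>UNIV. f j ^ card {t\<in>T. \<sigma> t = j}) = (\<Prod>t\<in>T. f (\<sigma> t))"
proof -
  have "(\<Prod>j\<in>UNIV. prod (\<lambda>t. f (\<sigma> t)) {t\<in>T. \<sigma> t = j}) = (\<Prod>t\<in>T. f (\<sigma> t))"
    by (rule prod.group) (use assms in auto)
  moreover have "prod (\<lambda>t. f (\<sigma> t)) {t\<in>T. \<sigma> t = j} = f j ^ card {t\<in>T. \<sigma> t = j}" for j
    by simp
  ultimately show ?thesis by simp
qed

section \<open>Dimensions of spaces of functions\<close>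

lemma sum_fun_apply: "(\<Sum>i\<in>A. F i) x = (\<Sum>i\<in>A. F i x)"
  by (induction A rule: infinite_finite_induct) auto

interpretation fs: vector_space "\<lambda>(c::'k::field) (f::'a \<Rightarrow> 'k) x. c * f x"
  by unfold_locales (auto simp: fun_eq_iff algebra_simps)

text \<open>
  The dimension together with its finiteness, so that a dimension of zero cannot stand for an
  infinite one.
\<close>

definition has_dim :: "('a \<Rightarrow> 'k::field) set \<Rightarrow> nat \<Rightarrow> bool" where
  "has_dim W N \<longleftrightarrow> (\<exists>B. fs.independent B \<and> finite B \<and> card B = N \<and> fs.span B = W)"

text \<open>
  Vectors that are linearly independent modulo a subspace raise the dimension by their number.
\<close>

lemma has_dim_extend:
  fixes T :: "('a \<Rightarrow> 'k::field) set"
  assumes "has_dim T N" and "fs.subspace T"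
    and "\<And>\<alpha>. (\<lambda>x. \<Sum>i<n. \<alpha> i * X i x) \<in> T \<Longrightarrow> \<forall>i<n. \<alpha> i = 0"
  shows "has_dim (fs.span (X ` {..<n} \<union> T)) (n + N)"
  using assms(3)
proof (induction n)
  case 0
  have "fs.span T = T" using assms(2) by (simp only: fs.span_eq_iff)
  then show ?case using assms(1) by (simp only: lessThan_0 image_empty Un_empty_left add_0)
next
  case (Suc n)
  let ?U = "X ` {..<n} \<union> T"
  have "has_dim (fs.span ?U) (n + N)"
  proof (rule Suc.IH)
    fix \<alpha> assume a: "(\<lambda>x. \<Sum>i<n. \<alpha> i * X i x) \<in> T"
    define \<beta> where "\<beta> i = (if i < n then \<alpha> i else 0)" for i
    have "(\<lambda>x. \<Sum>i<Suc n. \<beta> i * X i x) = (\<lambda>x. \<Sum>i<n. \<alpha> i * X i x)"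
      by (auto simp: \<beta>_def fun_eq_iff)
    then have "\<forall>i<Suc n. \<beta> i = 0" using a by (intro Suc.prems) simp
    then show "\<forall>i<n. \<alpha> i = 0" by (auto simp: \<beta>_def less_Suc_eq split: if_splits)
  qed
  then obtain B where B: "fs.independent B" "finite B" "card B = n + N" "fs.span B = fs.span ?U"
    unfolding has_dim_def by blast
  have "X n \<notin> fs.span ?U"
  proof
    assume "X n \<in> fs.span ?U"
    then obtain f t where ft: "X n = f + t" "f \<in> fs.span (X ` {..<n})" "t \<in> fs.span T"
      unfolding fs.span_Un by blast
    have "\<exists>\<alpha>. f = (\<lambda>x. \<Sum>i<n. \<alpha> i * X i x)"
      using ft(2)
    proof (induction rule: fs.span_induct_alt)
      case base
      show ?case by (intro exI[of _ "\<lambda>_. 0"]) (auto simp: fun_eq_iff)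
    next
      case (step c z y)
      then obtain i \<alpha> where i: "i < n" "z = X i" and y: "y = (\<lambda>x. \<Sum>i<n. \<alpha> i * X i x)" by blast
      have "(\<Sum>l<n. (\<alpha>(i := \<alpha> i + c)) l * X l x) = c * X i x + (\<Sum>l<n. \<alpha> l * X l x)" for x
      proof -
        have "(\<Sum>l<n. (\<alpha>(i := \<alpha> i + c)) l * X l x) = (\<Sum>l<n. \<alpha> l * X l x + (if l = i then c * X i x else 0))"
          by (intro sum.cong) (auto simp: algebra_simps)
        also have "\<dots> = c * X i x + (\<Sum>l<n. \<alpha> l * X l x)"
          using i by (simp add: sum.distrib add.commute)
        finally show ?thesis .
      qed
      then show ?case using i y by (intro exI[of _ "\<alpha>(i := \<alpha> i + c)"]) (auto simp: fun_eq_iff)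
    qed
    then obtain \<alpha> where \<alpha>: "f = (\<lambda>x. \<Sum>i<n. \<alpha> i * X i x)" by blast
    have t: "t \<in> T" using fs.span_minimal[OF subset_refl assms(2)] ft(3) by (rule subsetD)
    define \<beta> where "\<beta> i = (if i < n then - \<alpha> i else 1)" for i
    have "(\<lambda>x. \<Sum>i<Suc n. \<beta> i * X i x) = t"
      using ft(1) by (auto simp: \<beta>_def \<alpha> fun_eq_iff sum_negf)
    then have "\<forall>i<Suc n. \<beta> i = 0" using t by (intro Suc.prems) (simp only:)
    from this[rule_format, of n] show False by (simp add: \<beta>_def)
  qed
  then have Xn: "X n \<notin> fs.span B" using B(4) by simp
  then have XB: "X n \<notin> B" using fs.span_base by blast
  have "fs.span ({X n} \<union> B) = fs.span ({X n} \<union> ?U)"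
    unfolding fs.span_Un[of "{X n}"] B(4) ..
  moreover have "{X n} \<union> ?U = X ` {..<Suc n} \<union> T" by (auto simp: lessThan_Suc)
  ultimately have "fs.span (insert (X n) B) = fs.span (X ` {..<Suc n} \<union> T)" by simp
  then show ?case
    unfolding has_dim_def using B(2,3) XB fs.independent_insertI[OF Xn B(1)]
    by (intro exI[of _ "insert (X n) B"] conjI) simp_all
qed

section \<open>Graded pieces of the coordinate ring as spaces of functions\<close>

lemma eval_mat_superset:
  assumes "finite K" "Poly_Mapping.keys f \<subseteq> K"
  shows "eval_mat w f = (\<Sum>m\<in>K. Poly_Mapping.lookup f m *
      (\<Prod>i\<in>UNIV. \<Prod>j\<in>UNIV. (w $ i $ j) ^ Poly_Mapping.lookup m (i, j)))"
  unfolding eval_mat_def by (rule sum.mono_neutral_left) (use assms in \<open>auto simp: in_keys_iff\<close>)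

lemma eval_mat_add: "eval_mat w (f + g) = eval_mat w f + eval_mat w g"
proof -
  let ?K = "Poly_Mapping.keys f \<union> Poly_Mapping.keys g"
  have "eval_mat w h = (\<Sum>m\<in>?K. Poly_Mapping.lookup h m *
      (\<Prod>i\<in>UNIV. \<Prod>j\<in>UNIV. (w $ i $ j) ^ Poly_Mapping.lookup m (i, j)))"
    if "Poly_Mapping.keys h \<subseteq> ?K" for h
    using that by (intro eval_mat_superset) auto
  note this[of f] this[of g] this[of "f + g"]
  then show ?thesis using keys_add[of f g]
    by (simp add: lookup_add sum.distrib distrib_right)
qed

lemma lookup_const_mult:
  "Poly_Mapping.lookup (Poly_Mapping.single 0 c * f) m = (c::'k::comm_ring_1) * Poly_Mapping.lookup f m"
  unfolding mult_map_scale_conv_mult[symmetric] by (simp add: Poly_Mapping.map.rep_eq when_def)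

lemma eval_mat_const_mult: "eval_mat w (Poly_Mapping.single 0 c * f) = c * eval_mat w f"
proof -
  have "Poly_Mapping.keys (Poly_Mapping.single 0 c * f) \<subseteq> Poly_Mapping.keys f"
    by (auto simp: in_keys_iff lookup_const_mult)
  then show ?thesis
    by (subst eval_mat_superset[of "Poly_Mapping.keys f"])
      (auto simp: eval_mat_def lookup_const_mult sum_distrib_left mult.assoc)
qed

lemma eval_mat_sum: "eval_mat w (\<Sum>b\<in>B. F b) = (\<Sum>b\<in>B. eval_mat w (F b))"
proof (induction B rule: infinite_finite_induct)
  case (insert x B)
  then show ?case by (simp add: eval_mat_add)
qed (simp_all add: eval_mat_def)

lemma eval_mat_diff: "eval_mat w (f - g) = eval_mat w f - eval_mat w g"
  using eval_mat_add[of w "f - g" g] by simp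

text \<open>
  A polynomial that vanishes on \<open>Y\<close> vanishes on the closure, because its zero locus is one of
  the closed sets that are intersected.
\<close>

lemma vanishing_ideal_closure: "vanishing_ideal (zariski_closure Y) = vanishing_ideal Y"
proof
  have "Y \<subseteq> zariski_closure Y" by (auto simp: zariski_closure_def)
  then show "vanishing_ideal (zariski_closure Y) \<subseteq> vanishing_ideal Y"
    by (auto simp: vanishing_ideal_def)
  show "vanishing_ideal Y \<subseteq> vanishing_ideal (zariski_closure Y)"
  proof
    fix f assume f: "f \<in> vanishing_ideal Y"
    have "zariski_closed (zero_locus {f})" by (auto simp: zariski_closed_def)
    moreover have "Y \<subseteq> zero_locus {f}" using f by (auto simp: vanishing_ideal_def zero_locus_def)
    ultimately have "zariski_closure Y \<subseteq> zero_locus {f}" by (auto simp: zariski_closure_def)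
    then show "f \<in> vanishing_ideal (zariski_closure Y)"
      by (auto simp: vanishing_ideal_def zero_locus_def)
  qed
qed

lemma graded_piece_closed:
  "0 \<in> graded_piece d"
  "f \<in> graded_piece d \<Longrightarrow> g \<in> graded_piece d \<Longrightarrow> f + g \<in> graded_piece d"
  "f \<in> graded_piece d \<Longrightarrow> g \<in> graded_piece d \<Longrightarrow> f - g \<in> graded_piece d"
  "f \<in> graded_piece d \<Longrightarrow> Poly_Mapping.single 0 (c::'k::field) * f \<in> graded_piece d"
  using keys_add[of f g] by (auto simp: graded_piece_def in_keys_iff lookup_add lookup_minus lookup_const_mult)

lemma graded_piece_sum:
  "B \<subseteq> graded_piece d \<Longrightarrow> (\<Sum>b\<in>B. Poly_Mapping.single 0 (c b) * b) \<in> graded_piece d"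
  for B :: "('k::field, 'r::finite, 'n::finite) mat_poly set"
  by (induction B rule: infinite_finite_induct) (auto intro: graded_piece_closed)

lemma eval_mat_rescale_columns:
  fixes w :: "'k::field^'n::finite^'r::finite"
  assumes "f \<in> graded_piece d"
  shows "eval_mat (\<chi> i j. w $ i $ j * x j) f = (\<Prod>j\<in>UNIV. x j ^ nat (snd d $ j)) * eval_mat w f"
proof -
  have "(\<Prod>i\<in>UNIV. \<Prod>j\<in>UNIV. (w $ i $ j * x j) ^ Poly_Mapping.lookup m (i, j)) =
     (\<Prod>j\<in>UNIV. x j ^ nat (snd d $ j)) * (\<Prod>i\<in>UNIV. \<Prod>j\<in>UNIV. (w $ i $ j) ^ Poly_Mapping.lookup m (i, j))"
    if "m \<in> Poly_Mapping.keys f" for m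
  proof -
    have "monom_deg m = d" using that assms by (auto simp: graded_piece_def)
    then have "nat (snd d $ j) = (\<Sum>i\<in>UNIV. Poly_Mapping.lookup m (i, j))" for j
      by (auto simp: monom_deg_def simp flip: of_nat_sum)
    then show ?thesis
      by (simp add: power_mult_distrib prod.distrib prod.swap[of "\<lambda>i j. x j ^ _ i j" UNIV UNIV] power_sum mult.commute)
  qed
  then show ?thesis
    by (simp add: eval_mat_def sum_distrib_left mult.left_commute)
qed

text \<open>
  A homogeneous polynomial is multiplied by a nonzero scalar when columns are rescaled, so only the
  action of the general linear group has to be considered.
\<close>

lemma homogeneous_in_orbit_ideal_iff:
  fixes v :: "'k::field^'n::finite^'r::finite"
  assumes "f \<in> graded_piece d"
  shows "f \<in> vanishing_ideal (matrix_orbit_closure v) \<longleftrightarrow> (\<forall>g. invertible g \<longrightarrow> eval_mat (g ** v) f = 0)"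
proof -
  have "f \<in> vanishing_ideal (matrix_orbit_closure v) \<longleftrightarrow> f \<in> vanishing_ideal (matrix_orbit v)"
    by (simp add: matrix_orbit_closure_def vanishing_ideal_closure)
  also have "\<dots> \<longleftrightarrow> (\<forall>g x. invertible g \<longrightarrow> (\<forall>j. x j \<noteq> 0) \<longrightarrow>
      eval_mat (\<chi> i j. (g ** v) $ i $ j * x j) f = 0)"
    by (auto simp: vanishing_ideal_def matrix_orbit_def)
  also have "\<dots> \<longleftrightarrow> (\<forall>g. invertible g \<longrightarrow> eval_mat (g ** v) f = 0)"
    unfolding eval_mat_rescale_columns[OF assms] by (auto intro: exI[of _ "\<lambda>_. 1"])
  finally show ?thesis .
qed

text \<open>
  The factor \<open>det g\<close> makes the values on singular matrices zero. Equality of two such functions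
  is therefore equality on the group, where further factors \<open>det g\<close> can be cancelled.
\<close>

definition twisted_eval :: "'k::field^'n::finite^'r::finite \<Rightarrow> ('k, 'r, 'n) mat_poly \<Rightarrow> 'k^'r^'r \<Rightarrow> 'k" where
  "twisted_eval v f g = det g * eval_mat (g ** v) f"

lemma twisted_eval_eq_0_iff:
  fixes v :: "'k::field^'n::finite^'r::finite"
  assumes "f \<in> graded_piece d"
  shows "twisted_eval v f = (\<lambda>_. 0) \<longleftrightarrow> f \<in> vanishing_ideal (matrix_orbit_closure v)"
  unfolding homogeneous_in_orbit_ideal_iff[OF assms] by (auto simp: twisted_eval_def fun_eq_iff invertible_det_nz)

lemma twisted_eval_lincomb:
  "twisted_eval v (\<Sum>b\<in>B. Poly_Mapping.single 0 (c b) * b) = (\<Sum>b\<in>B. (\<lambda>x. c b * twisted_eval v b x))"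
  by (auto simp: twisted_eval_def fun_eq_iff eval_mat_sum eval_mat_const_mult sum_distrib_left sum_fun_apply
      mult.left_commute)

lemma twisted_eval_diff: "twisted_eval v (f - g) = twisted_eval v f - twisted_eval v g"
  by (auto simp: twisted_eval_def fun_eq_iff eval_mat_diff right_diff_distrib)

text \<open>
  Twisted evaluation has the ideal as its kernel on each graded piece, so a set of polynomials is a
  basis of the quotient iff it is mapped bijectively to a basis of the image. Existence is obtained by
  lifting a basis of the image, uniqueness of the cardinality from the image of a given basis.
\<close>

lemma hilbert_function_eqI:
  fixes v :: "'k::field^'n::finite^'r::finite"
  assumes "has_dim (twisted_eval v ` graded_piece d) N"
  shows "hilbert_function (vanishing_ideal (matrix_orbit_closure v)) d = N"
proof -
  let ?I = "vanishing_ideal (matrix_orbit_closure v)"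
  let ?\<Phi> = "twisted_eval v"
  obtain C where C: "fs.independent C" "finite C" "card C = N" "fs.span C = ?\<Phi> ` graded_piece d"
    using assms unfolding has_dim_def by blast
  have card: "card B = N" if B: "quotient_basis ?I d B" for B
  proof -
    have Bg: "B \<subseteq> graded_piece d" and fB: "finite B" using B by (auto simp: quotient_basis_def)
    have indB: "\<forall>b\<in>B. c b = 0" if "(\<Sum>b\<in>B. (\<lambda>x. c b * ?\<Phi> b x)) = (\<lambda>_. 0)" for c
    proof -
      have "(\<Sum>b\<in>B. Poly_Mapping.single 0 (c b) * b) \<in> ?I"
        by (rule twisted_eval_eq_0_iff[OF graded_piece_sum[OF Bg, of c], THEN iffD1])
          (simp only: twisted_eval_lincomb that)
      with B show ?thesis unfolding quotient_basis_def by blast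
    qed
    have inj: "inj_on ?\<Phi> B"
    proof (rule inj_onI, rule ccontr)
      fix x y assume xy: "x \<in> B" "y \<in> B" "?\<Phi> x = ?\<Phi> y" "x \<noteq> y"
      define c :: "('k, 'r, 'n) mat_poly \<Rightarrow> 'k" where "c b = (if b = x then 1 else if b = y then -1 else 0)" for b
      have "(\<Sum>b\<in>B. (\<lambda>z. c b * ?\<Phi> b z)) = (\<Sum>b\<in>{x,y}. (\<lambda>z. c b * ?\<Phi> b z))"
        by (rule sum.mono_neutral_right) (use xy fB in \<open>auto simp: c_def fun_eq_iff\<close>)
      also have "\<dots> = (\<lambda>_. 0)" using xy by (auto simp: c_def fun_eq_iff)
      finally have "c x = 0" using indB[of c] xy(1) by (simp only: ball_simps)
      then show False by (simp add: c_def)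
    qed
    have "fs.independent (?\<Phi> ` B)"
    proof (rule fs.independent_if_scalars_zero)
      fix c x assume 0: "(\<Sum>x\<in>?\<Phi> ` B. (\<lambda>z. c x * x z)) = 0" and x: "x \<in> ?\<Phi> ` B"
      from 0 have "(\<Sum>b\<in>B. (\<lambda>z. c (?\<Phi> b) * ?\<Phi> b z)) = (\<lambda>_. 0)"
        unfolding sum.reindex[OF inj] comp_def zero_fun_def .
      from indB[OF this] x show "c x = 0" by blast
    qed (use fB in simp)
    moreover have "fs.span (?\<Phi> ` B) = fs.span C"
    proof
      show "fs.span (?\<Phi> ` B) \<subseteq> fs.span C"
      proof (rule fs.span_minimal)
        show "?\<Phi> ` B \<subseteq> fs.span C" unfolding C(4) using Bg by blast
      qed (rule fs.subspace_span)
      show "fs.span C \<subseteq> fs.span (?\<Phi> ` B)"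
      proof
        fix F assume "F \<in> fs.span C"
        then obtain f where f: "f \<in> graded_piece d" "F = ?\<Phi> f" unfolding C(4) by blast
        then obtain c where c: "f - (\<Sum>b\<in>B. Poly_Mapping.single 0 (c b) * b) \<in> ?I"
          using B unfolding quotient_basis_def by blast
        have "?\<Phi> (f - (\<Sum>b\<in>B. Poly_Mapping.single 0 (c b) * b)) = (\<lambda>_. 0)"
          using c twisted_eval_eq_0_iff[OF graded_piece_closed(3)[OF f(1) graded_piece_sum[OF Bg, of c]]] by blast
        then have "F = (\<Sum>b\<in>B. (\<lambda>x. c b * ?\<Phi> b x))"
          unfolding twisted_eval_lincomb[symmetric] f(2) twisted_eval_diff
          by (subst eq_iff_diff_eq_0) (simp only: zero_fun_def)
        then show "F \<in> fs.span (?\<Phi> ` B)"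
          by (elim ssubst) (intro fs.span_sum fs.span_scale fs.span_base imageI)
      qed
    qed
    ultimately have "card (?\<Phi> ` B) = card C"
      using C by (metis fs.dim_span_eq_card_independent)
    then show ?thesis using inj C(3) by (simp add: card_image)
  qed
  have "\<exists>B. quotient_basis ?I d B"
  proof -
    have sub: "C \<subseteq> ?\<Phi> ` graded_piece d" using C(4) fs.span_superset by blast
    have "\<forall>x\<in>C. \<exists>f. f \<in> graded_piece d \<and> ?\<Phi> f = x" using sub by blast
    from bchoice[OF this] obtain \<psi> where "\<forall>x\<in>C. \<psi> x \<in> graded_piece d \<and> ?\<Phi> (\<psi> x) = x" ..
    then have \<psi>: "\<psi> x \<in> graded_piece d" "?\<Phi> (\<psi> x) = x" if "x \<in> C" for x using that by blast+
    let ?B = "\<psi> ` C"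
    have inj: "inj_on \<psi> C" by (rule inj_on_inverseI[of _ ?\<Phi>]) (simp add: \<psi>(2))
    have Bg: "?B \<subseteq> graded_piece d" using \<psi>(1) by (rule image_subsetI)
    have lin: "?\<Phi> (\<Sum>b\<in>?B. Poly_Mapping.single 0 (c b) * b) = (\<Sum>x\<in>C. (\<lambda>z. c (\<psi> x) * x z))" for c
      unfolding twisted_eval_lincomb unfolding sum.reindex[OF inj] comp_def
      by (intro sum.cong refl) (simp add: \<psi>(2))
    have "\<forall>b\<in>?B. c b = 0" if "(\<Sum>b\<in>?B. Poly_Mapping.single 0 (c b) * b) \<in> ?I" for c
    proof -
      have "(\<Sum>x\<in>C. (\<lambda>z. c (\<psi> x) * x z)) = 0"
        unfolding lin[symmetric] zero_fun_def twisted_eval_eq_0_iff[OF graded_piece_sum[OF Bg, of c]] by (rule that)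
      from fs.independentD[OF C(1,2) subset_refl this] have "c (\<psi> x) = 0" if "x \<in> C" for x
        using that by simp
      then show ?thesis by (simp add: ball_simps)
    qed
    moreover have "\<exists>c. f - (\<Sum>b\<in>?B. Poly_Mapping.single 0 (c b) * b) \<in> ?I" if f: "f \<in> graded_piece d" for f
    proof -
      have "?\<Phi> f \<in> fs.span C" using f C(4) by blast
      then obtain c where c: "?\<Phi> f = (\<Sum>x\<in>C. (\<lambda>z. c x * x z))"
        unfolding fs.span_finite[OF C(2)] by (rule rangeE)
      define c' where "c' b = c (inv_into C \<psi> b)" for b
      have "(\<Sum>x\<in>C. (\<lambda>z. c' (\<psi> x) * x z)) = ?\<Phi> f"
        unfolding c c'_def by (intro sum.cong refl) (simp add: inv_into_f_f[OF inj])
      then have "?\<Phi> f = ?\<Phi> (\<Sum>b\<in>?B. Poly_Mapping.single 0 (c' b) * b)" unfolding lin ..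
      then have "?\<Phi> (f - (\<Sum>b\<in>?B. Poly_Mapping.single 0 (c' b) * b)) = (\<lambda>_. 0)"
        unfolding twisted_eval_diff by (simp add: zero_fun_def)
      then show ?thesis
        by (intro exI[of _ c'] twisted_eval_eq_0_iff[THEN iffD1, OF graded_piece_closed(3)[OF f graded_piece_sum[OF Bg, of c']]])
    qed
    ultimately show ?thesis unfolding quotient_basis_def
      using Bg C(2) by (intro exI[of _ ?B] conjI allI impI) (assumption | rule finite_imageI | blast)+
  qed
  then show ?thesis unfolding hilbert_function_def using card by (intro the_equality) blast+
qed

section \<open>The filtration by powers of the determinant\<close>

definition minor :: "'k::comm_ring_1^'n^2 \<Rightarrow> 'n \<Rightarrow> 'n \<Rightarrow> 'k" where
  "minor v i j = v $ 1 $ i * v $ 2 $ j - v $ 1 $ j * v $ 2 $ i"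

text \<open>
  The minors of \<open>g ** v\<close> are the source of all factors \<open>det g\<close> in what follows.
\<close>

lemma minor_mult: "minor (g ** v) i j = det g * minor v i j"
  by (simp add: minor_def det_2 matrix_matrix_mult_def sum_2 algebra_simps)

lemma minor_nonzero:
  fixes v :: "'k::field^'n::finite^2"
  assumes "uniform_rank2 v" "i \<noteq> j"
  shows "minor v i j \<noteq> 0"
proof
  assume 0: "minor v i j = 0"
  let ?x = "column i v" and ?y = "column j v"
  have cols: "?x \<noteq> ?y \<and> vec.independent {?x, ?y}"
    using assms(1)[unfolded uniform_rank2_def, THEN conjunct2, rule_format, OF assms(2)] .
  note ne = cols[THEN conjunct1] and ind = cols[THEN conjunct2]
  have "?x \<noteq> 0"
  proof
    assume "?x = 0"
    then have "0 \<in> {?x, ?y}" by simp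
    from vec.dependent_zero[OF this] ind show False by (rule notE[rotated])
  qed
  then have "\<exists>c. ?y = c *s ?x"
  proof (cases "v $ 1 $ i = 0")
    case False
    then have "?y = (v $ 1 $ j / v $ 1 $ i) *s ?x"
      using 0 by (auto simp: vec_eq_iff forall_2 column_def minor_def field_simps)
    then show ?thesis by blast
  next
    case True
    then have "v $ 2 $ i \<noteq> 0" using \<open>?x \<noteq> 0\<close> by (auto simp: vec_eq_iff forall_2 column_def)
    then have "?y = (v $ 2 $ j / v $ 2 $ i) *s ?x"
      using 0 True by (auto simp: vec_eq_iff forall_2 column_def minor_def field_simps)
    then show ?thesis by blast
  qed
  then obtain c where "?y = c *s ?x" by blast
  then have "?y \<in> vec.span {?x}" using vec.span_scale[OF vec.span_base[of ?x "{?x}"]] by simp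
  moreover have "{?x, ?y} - {?y} = {?x}" using ne by (simp add: insert_Diff_if)
  ultimately have "?y \<in> vec.span ({?x, ?y} - {?y})" by (simp only:)
  then have "vec.dependent {?x, ?y}" unfolding vec.dependent_def by blast
  then show False using ind by (rule notE[rotated])
qed

definition row_monomial :: "'k::comm_ring_1^'n::finite^2 \<Rightarrow> ('n \<Rightarrow> nat) \<Rightarrow> ('n \<Rightarrow> nat) \<Rightarrow> 'k^2^2 \<Rightarrow> 'k" where
  "row_monomial v p r g = (\<Prod>j\<in>UNIV. (g ** v) $ 1 $ j ^ p j * (g ** v) $ 2 $ j ^ r j)"

abbreviation incr :: "('n \<Rightarrow> nat) \<Rightarrow> 'n \<Rightarrow> 'n \<Rightarrow> nat" where
  "incr p i \<equiv> p(i := Suc (p i))"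

lemma sum_incr: "sum (incr p i) UNIV = Suc (sum p UNIV)" for i :: "'n::finite"
proof -
  have "sum (incr p i) UNIV = (\<Sum>j\<in>UNIV. p j + (if j = i then 1 else 0))"
    by (intro sum.cong) auto
  then show ?thesis by (simp add: sum.distrib)
qed

lemma row_monomial_incr:
  "row_monomial v (incr p i) r g = (g ** v) $ 1 $ i * row_monomial v p r g"
  "row_monomial v p (incr r i) g = (g ** v) $ 2 $ i * row_monomial v p r g"
proof -
  have "row_monomial v (incr p i) r g =
      (\<Prod>j\<in>UNIV. (if j = i then (g ** v) $ 1 $ i else 1) * ((g ** v) $ 1 $ j ^ p j * (g ** v) $ 2 $ j ^ r j))"
    unfolding row_monomial_def by (intro prod.cong) (auto simp: mult.assoc)
  then show "row_monomial v (incr p i) r g = (g ** v) $ 1 $ i * row_monomial v p r g"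
    by (simp add: prod.distrib row_monomial_def)
  have "row_monomial v p (incr r i) g =
      (\<Prod>j\<in>UNIV. (if j = i then (g ** v) $ 2 $ i else 1) * ((g ** v) $ 1 $ j ^ p j * (g ** v) $ 2 $ j ^ r j))"
    unfolding row_monomial_def by (intro prod.cong) (auto simp: mult.left_commute)
  then show "row_monomial v p (incr r i) g = (g ** v) $ 2 $ i * row_monomial v p r g"
    by (simp add: prod.distrib row_monomial_def)
qed

text \<open>
  Exchanging the rows in which one factor from column \<open>i\<close> and one from column \<open>j\<close> are evaluated
  costs a minor of \<open>g ** v\<close>.
\<close>

lemma row_monomial_swap:
  "row_monomial v (incr p i) (incr r j) g - row_monomial v (incr p j) (incr r i) g =
    minor v i j * (det g * row_monomial v p r g)"
proof -
  have "row_monomial v (incr p i) (incr r j) g - row_monomial v (incr p j) (incr r i) g =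
     minor (g ** v) i j * row_monomial v p r g"
    unfolding row_monomial_incr minor_def by (simp add: algebra_simps)
  then show ?thesis by (simp add: minor_mult mult_ac)
qed

text \<open>
  Exponents of the two rows in layer \<open>k\<close>. The defects \<open>b j - (p j + r j)\<close> add up to \<open>2 * k\<close> and
  none of them exceeds \<open>k\<close>, so that \<open>b - p - r\<close> is the degree sequence of a loopless multigraph
  with \<open>k\<close> edges; each edge stands for a minor that has been split off.
\<close>

definition layer_exponents :: "('n::finite \<Rightarrow> nat) \<Rightarrow> nat \<Rightarrow> nat \<Rightarrow> nat \<Rightarrow> (('n \<Rightarrow> nat) \<times> ('n \<Rightarrow> nat)) set" where
  "layer_exponents b a1 a2 k = {(p, r). sum p UNIV + k = a1 \<and> sum r UNIV + k = a2 \<and>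
     (\<forall>j. p j + r j \<le> b j \<and> b j \<le> p j + r j + k)}"

text \<open>
  One of the factors \<open>det g\<close> is that of \<open>twisted_eval\<close>, the others have been split off.
\<close>

definition layer_gen :: "'k::field^'n::finite^2 \<Rightarrow> nat \<Rightarrow> ('n \<Rightarrow> nat) \<Rightarrow> ('n \<Rightarrow> nat) \<Rightarrow> 'k^2^2 \<Rightarrow> 'k" where
  "layer_gen v k p r g = det g ^ Suc k * row_monomial v p r g"

definition layer :: "'k::field^'n::finite^2 \<Rightarrow> ('n \<Rightarrow> nat) \<Rightarrow> nat \<Rightarrow> nat \<Rightarrow> nat \<Rightarrow> ('k^2^2 \<Rightarrow> 'k) set" where
  "layer v b a1 a2 k = fs.span ((\<lambda>(p, r). layer_gen v k p r) ` layer_exponents b a1 a2 k)"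

lemma layer_gen_in_layer: "(p, r) \<in> layer_exponents b a1 a2 k \<Longrightarrow> layer_gen v k p r \<in> layer v b a1 a2 k"
  unfolding layer_def by (rule fs.span_base) (auto intro!: rev_image_eqI)

lemma layer_subspace: "fs.subspace (layer v b a1 a2 k)"
  unfolding layer_def by (rule fs.subspace_span)

lemma layer_gen_swap:
  "layer_gen v k (incr p i) (incr r j) - layer_gen v k (incr p j) (incr r i) =
     (\<lambda>g. minor v i j * layer_gen v (Suc k) p r g)"
  using row_monomial_swap[of v p i r j]
  by (simp add: fun_eq_iff layer_gen_def mult_ac flip: right_diff_distrib)

lemma layer_gen_swap_mem:
  assumes "(incr p i, incr r j) \<in> layer_exponents b a1 a2 k" "i \<noteq> j"
  shows "layer_gen v k (incr p i) (incr r j) - layer_gen v k (incr p j) (incr r i) \<in> layer v b a1 a2 (Suc k)"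
proof -
  have bd: "incr p i l + incr r j l \<le> b l \<and> b l \<le> incr p i l + incr r j l + k" for l
    using assms by (auto simp: layer_exponents_def simp del: fun_upd_apply)
  have "p l + r l \<le> b l \<and> b l \<le> p l + r l + Suc k" for l
    using bd[of l] assms(2) by (cases "l = i"; cases "l = j") auto
  then have "(p, r) \<in> layer_exponents b a1 a2 (Suc k)"
    using assms by (auto simp: layer_exponents_def sum_incr simp del: fun_upd_apply)
  then show ?thesis
    unfolding layer_gen_swap by (intro fs.subspace_scale[OF layer_subspace] layer_gen_in_layer)
qed

text \<open>
  Two exponent pairs with the same total are connected by swaps of one factor in each direction,
  and each swap brings \<open>p\<close> closer to \<open>p'\<close>.
\<close>

lemma layer_gen_cong_mod_next:
  fixes v :: "'k::field^'n::finite^2"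
  assumes "(p, r) \<in> layer_exponents b a1 a2 k" "(p', r') \<in> layer_exponents b a1 a2 k"
    and "\<And>j. p j + r j = p' j + r' j"
  shows "layer_gen v k p r - layer_gen v k p' r' \<in> layer v b a1 a2 (Suc k)"
  using assms(1,3)
proof (induction "\<Sum>j\<in>UNIV. p j - p' j" arbitrary: p r rule: less_induct)
  case less
  have sums: "sum p UNIV = sum p' UNIV" using less.prems(1) assms(2) by (auto simp: layer_exponents_def)
  show ?case
  proof (cases "\<exists>i. p' i < p i")
    case False
    then have le: "p i \<le> p' i" for i by (simp add: not_less)
    have "p i = p' i" for i
    proof (rule ccontr)
      assume "p i \<noteq> p' i"
      then have "p i < p' i" using le[of i] by simp
      then have "sum p UNIV < sum p' UNIV" using le by (intro sum_strict_mono_ex1) auto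
      then show False using sums by simp
    qed
    then have "p = p'" ..
    moreover from this have "r = r'" using less.prems(2) by (simp add: fun_eq_iff)
    ultimately show ?thesis by (simp add: fs.subspace_0[OF layer_subspace])
  next
    case True
    then obtain i where i: "p' i < p i" by blast
    have "\<exists>j. p j < p' j"
    proof (rule ccontr)
      assume "\<nexists>j. p j < p' j"
      then have "\<forall>j. p' j \<le> p j" by (simp add: not_less)
      then have "sum p' UNIV < sum p UNIV" using i by (intro sum_strict_mono_ex1) auto
      then show False using sums by simp
    qed
    then obtain j where j: "p j < p' j" by blast
    then have ij: "i \<noteq> j" using i by auto
    have rj: "r' j < r j" using less.prems(2)[of j] j by linarith
    define p0 where "p0 = p(i := p i - 1)"
    define r0 where "r0 = r(j := r j - 1)"
    have p: "p = incr p0 i" and r: "r = incr r0 j"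
      using i rj by (auto simp: p0_def r0_def fun_eq_iff)
    let ?p = "incr p0 j" and ?r = "incr r0 i"
    have eq: "?p l + ?r l = p l + r l" for l
      using ij by (simp add: p r)
    have mem: "(?p, ?r) \<in> layer_exponents b a1 a2 k"
    proof -
      have "sum ?p UNIV = sum p UNIV" "sum ?r UNIV = sum r UNIV"
        unfolding p r by (simp_all only: sum_incr)
      then show ?thesis using less.prems(1) eq by (simp add: layer_exponents_def del: fun_upd_apply)
    qed
    have "(\<Sum>l\<in>UNIV. ?p l - p' l) < (\<Sum>l\<in>UNIV. p l - p' l)"
    proof (rule sum_strict_mono_ex1)
      show "\<forall>l\<in>UNIV. ?p l - p' l \<le> p l - p' l" using i j by (auto simp: p0_def)
      show "\<exists>l\<in>UNIV. ?p l - p' l < p l - p' l"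
        by (rule bexI[of _ i]) (use i ij in \<open>auto simp: p0_def\<close>)
    qed simp
    then have "layer_gen v k ?p ?r - layer_gen v k p' r' \<in> layer v b a1 a2 (Suc k)"
      using less.prems(2) eq by (intro less.hyps mem) (simp_all del: fun_upd_apply)
    moreover have "layer_gen v k p r - layer_gen v k ?p ?r \<in> layer v b a1 a2 (Suc k)"
      using less.prems(1) ij unfolding p r by (rule layer_gen_swap_mem)
    ultimately show ?thesis using fs.subspace_add[OF layer_subspace] by fastforce
  qed
qed

text \<open>
  A generator of the next layer is, up to a nonzero minor, the difference of two generators of this
  layer. The columns \<open>i\<close> and \<open>j\<close> of the minor must include every column whose defect attains
  the bound \<open>Suc k\<close>; there are at most two such columns since the defects add up to \<open>2 * Suc k\<close>, so
  the two columns of largest defect do.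
\<close>

lemma layer_Suc_subset:
  fixes v :: "'k::field^'n::finite^2"
  assumes "uniform_rank2 v" "a1 + a2 = sum b UNIV"
  shows "layer v b a1 a2 (Suc k) \<subseteq> layer v b a1 a2 k"
proof -
  have "layer_gen v (Suc k) p r \<in> layer v b a1 a2 k" if pr: "(p, r) \<in> layer_exponents b a1 a2 (Suc k)" for p r
  proof -
    define c where "c l = b l - (p l + r l)" for l
    have le: "p l + r l \<le> b l" "b l \<le> p l + r l + Suc k" for l
      using pr by (auto simp: layer_exponents_def)
    have ck: "c l \<le> Suc k" for l using le[of l] by (simp add: c_def)
    have "(\<Sum>l\<in>UNIV. c l + (p l + r l)) = sum b UNIV"
      using le by (intro sum.cong) (auto simp: c_def)
    then have csum: "sum c UNIV = 2 * Suc k"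
      using pr assms(2) by (auto simp: layer_exponents_def sum.distrib)
    \<comment> \<open>The columns \<open>i\<close> and \<open>j\<close> have the two largest defects.\<close>
    obtain i where i: "\<And>l. c l \<le> c i"
    proof -
      have "Max (range c) \<in> range c" by (intro Max_in) auto
      then obtain i where "Max (range c) = c i" by (rule rangeE)
      then have "c l \<le> c i" for l by (metis Max_ge finite finite_imageI rangeI)
      then show ?thesis using that by blast
    qed
    have "sum c (UNIV - {i}) = 2 * Suc k - c i" using csum by (simp add: sum_diff1_nat)
    then have pos: "sum c (UNIV - {i}) \<noteq> 0" using ck[of i] by simp
    then have ne: "UNIV - {i} \<noteq> {}" by (metis sum.empty)
    obtain j where j: "j \<noteq> i" "\<And>l. l \<noteq> i \<Longrightarrow> c l \<le> c j"
    proof -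
      have "Max (c ` (UNIV - {i})) \<in> c ` (UNIV - {i})" using ne by (intro Max_in) auto
      then obtain j where j: "Max (c ` (UNIV - {i})) = c j" "j \<in> UNIV - {i}" by (rule imageE)
      then have "c l \<le> c j" if "l \<noteq> i" for l
        using Max_ge[of "c ` (UNIV - {i})" "c l"] that by simp
      moreover have "j \<noteq> i" using j by simp
      ultimately show ?thesis using that by blast
    qed
    have cj: "c j \<noteq> 0" using pos j by (metis (mono_tags, lifting) Diff_iff insertI1 le_zero_eq sum.neutral)
    then have ci: "c i \<noteq> 0" using i[of j] by simp
    have others: "c l \<le> k" if "l \<noteq> i" "l \<noteq> j" for l
    proof (rule ccontr)
      assume "\<not> c l \<le> k"
      then have "c l = Suc k" using ck[of l] by simp
      moreover have "c l \<le> c j" "c l \<le> c i" using that i j by auto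
      moreover have "c i + c j + c l \<le> sum c UNIV"
      proof -
        have "sum c {i, j, l} \<le> sum c UNIV" by (rule sum_mono2) auto
        then show ?thesis using that j by simp
      qed
      ultimately show False using csum by simp
    qed
    have bound: "incr p i l + incr r j l \<le> b l \<and> b l \<le> incr p i l + incr r j l + k" for l
      using others[of l] ci cj le[of l] j(1) ck[of l] by (cases "l = i"; cases "l = j") (auto simp: c_def)
    have m1: "(incr p i, incr r j) \<in> layer_exponents b a1 a2 k"
      using pr bound by (auto simp: layer_exponents_def sum_incr simp del: fun_upd_apply)
    have "incr p j l + incr r i l = incr p i l + incr r j l" for l using j(1) by simp
    then have m2: "(incr p j, incr r i) \<in> layer_exponents b a1 a2 k"
      using pr bound by (auto simp: layer_exponents_def sum_incr simp del: fun_upd_apply)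
    have "layer_gen v (Suc k) p r = (\<lambda>g. inverse (minor v i j) * 
        (layer_gen v k (incr p i) (incr r j) - layer_gen v k (incr p j) (incr r i)) g)"
      unfolding layer_gen_swap using minor_nonzero[OF assms(1), of i j] j(1) by auto
    also have "\<dots> \<in> layer v b a1 a2 k"
      by (intro fs.subspace_scale[OF layer_subspace] fs.subspace_diff[OF layer_subspace] layer_gen_in_layer m1 m2)
    finally show ?thesis .
  qed
  then show ?thesis
    unfolding layer_def[of v b a1 a2 "Suc k"] by (intro fs.span_minimal layer_subspace) auto
qed

section \<open>Polarisation\<close>

text \<open>
  If $f = \prod_j \ell_j^{q_j}$ then $f(g_1 + \epsilon g_2)$ is a polynomial in $\epsilon$, and its
  coefficients are, up to binomial coefficients, the polarisations of \<open>f\<close>. Being coefficients of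
  values of \<open>f\<close>, they respect linear relations between such products.
\<close>

definition polar :: "'k::field^'n::finite^2 \<Rightarrow> ('n \<Rightarrow> nat) \<Rightarrow> nat \<Rightarrow> 'k^2^2 \<Rightarrow> 'k" where
  "polar v q c g = coeff (\<Prod>j\<in>UNIV. [:(g ** v) $ 1 $ j, (g ** v) $ 2 $ j:] ^ q j) c"

text \<open>
  One element for each linear factor of $\prod_j \ell_j^{q_j}$, counted with multiplicity.
\<close>

definition factor_slots :: "('n::finite \<Rightarrow> nat) \<Rightarrow> ('n \<times> nat) set" where
  "factor_slots q = Sigma UNIV (\<lambda>j. {..<q j})"

definition slot_count :: "('n \<times> nat) set \<Rightarrow> 'n \<Rightarrow> nat" where
  "slot_count A j = card {t. (j, t) \<in> A}"

lemma finite_factor_slots [simp]: "finite (factor_slots q)"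
  by (simp add: factor_slots_def)

lemma card_factor_slots: "card (factor_slots q) = sum q UNIV"
  by (simp add: factor_slots_def card_SigmaI)

lemma prod_slots:
  fixes A :: "('n::finite \<times> nat) set" and f :: "'n \<Rightarrow> 'a::comm_monoid_mult"
  assumes "finite A"
  shows "(\<Prod>z\<in>A. f (fst z)) = (\<Prod>j\<in>UNIV. f j ^ slot_count A j)"
proof -
  have "(\<Prod>j\<in>UNIV. prod (\<lambda>z. f (fst z)) {z\<in>A. fst z = j}) = (\<Prod>z\<in>A. f (fst z))"
    by (rule prod.group) (use assms in auto)
  moreover have "prod (\<lambda>z. f (fst z)) {z\<in>A. fst z = j} = f j ^ slot_count A j" for j
  proof -
    have "{z\<in>A. fst z = j} = Pair j ` {t. (j, t) \<in> A}" by force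
    then have "card {z\<in>A. fst z = j} = slot_count A j"
      by (simp add: slot_count_def card_image inj_on_def)
    then show ?thesis by simp
  qed
  ultimately show ?thesis by simp
qed

lemma sum_slot_count: "finite A \<Longrightarrow> sum (slot_count A) UNIV = card A" for A :: "('n::finite \<times> nat) set"
proof -
  assume A: "finite A"
  have eq: "A = Sigma UNIV (\<lambda>j. {t. (j, t) \<in> A})" by auto
  have "finite {t. (j, t) \<in> A}" for j
    using finite_vimageI[OF A, of "Pair j"] by (simp add: vimage_def inj_def)
  then have "card (Sigma UNIV (\<lambda>j. {t. (j, t) \<in> A})) = (\<Sum>j\<in>UNIV. card {t. (j, t) \<in> A})"
    by (intro card_SigmaI) auto
  then show ?thesis unfolding eq[symmetric] by (simp add: slot_count_def)
qed

lemma slot_count_complement: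
  assumes "X \<subseteq> factor_slots q"
  shows "slot_count (factor_slots q - X) j + slot_count X j = q j"
proof -
  have "{t. (j, t) \<in> X} \<subseteq> {..<q j}" using assms by (auto simp: factor_slots_def)
  moreover have "{t. (j, t) \<in> factor_slots q - X} = {..<q j} - {t. (j, t) \<in> X}"
    by (auto simp: factor_slots_def)
  moreover have "card ({..<q j} - Y) + card Y = q j" if "Y \<subseteq> {..<q j}" for Y
    using card_Diff_subset[OF finite_subset[OF that finite_lessThan] that] card_mono[OF finite_lessThan that]
    by simp
  ultimately show ?thesis
    unfolding slot_count_def by (simp only:)
qed

text \<open>
  Choosing the set \<open>X\<close> of factors that are evaluated at the second row.
\<close>

lemma polar_expansion:
  fixes v :: "'k::field^'n::finite^2"
  shows "polar v q c g = (\<Sum>X | X \<subseteq> factor_slots q \<and> card X = c.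
     row_monomial v (slot_count (factor_slots q - X)) (slot_count X) g)"
proof -
  let ?I = "factor_slots q"
  define x where "x j = (g ** v) $ 1 $ j" for j
  define y where "y j = (g ** v) $ 2 $ j" for j
  have cnt: "slot_count ?I j = q j" for j
    using slot_count_complement[of "{}" q j] by (simp add: slot_count_def)
  have "(\<Prod>j\<in>UNIV. [:x j, y j:] ^ q j) = (\<Prod>z\<in>?I. [:0, y (fst z):] + [:x (fst z):])"
    by (simp add: prod_slots[of ?I "\<lambda>j. [:x j, y j:]"] cnt)
  also have "\<dots> = (\<Sum>X\<in>Pow ?I. (\<Prod>z\<in>X. [:0, y (fst z):]) * (\<Prod>z\<in>?I - X. [:x (fst z):]))"
    by (rule prod_add) simp
  also have "coeff \<dots> c = (\<Sum>X\<in>Pow ?I. if card X = c then row_monomial v (slot_count (?I - X)) (slot_count X) g else 0)"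
    unfolding coeff_sum
  proof (intro sum.cong refl)
    fix X assume "X \<in> Pow ?I"
    then have fin: "finite X" "finite (?I - X)" using finite_subset[OF _ finite_factor_slots] by auto
    have "(\<Prod>z\<in>X. [:0, y (fst z):]) = monom (\<Prod>z\<in>X. y (fst z)) (card X)" 
      using fin(1) by induction (auto simp: monom_altdef mult_ac)
    moreover have "(\<Prod>z\<in>?I - X. [:x (fst z):]) = [:\<Prod>z\<in>?I - X. x (fst z):]"
      using fin(2) by induction (auto simp: one_pCons)
    ultimately have "coeff ((\<Prod>z\<in>X. [:0, y (fst z):]) * (\<Prod>z\<in>?I - X. [:x (fst z):])) c =
        (if card X = c then (\<Prod>z\<in>X. y (fst z)) * (\<Prod>z\<in>?I - X. x (fst z)) else 0)"
      by simp
    also have "(\<Prod>z\<in>X. y (fst z)) * (\<Prod>z\<in>?I - X. x (fst z)) = row_monomial v (slot_count (?I - X)) (slot_count X) g"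
      unfolding prod_slots[OF fin(1)] prod_slots[OF fin(2)]
      by (simp add: row_monomial_def x_def y_def prod.distrib mult.commute)
    finally show "coeff ((\<Prod>z\<in>X. [:0, y (fst z):]) * (\<Prod>z\<in>?I - X. [:x (fst z):])) c =
        (if card X = c then row_monomial v (slot_count (?I - X)) (slot_count X) g else 0)" .
  qed
  also have "\<dots> = (\<Sum>X | X \<subseteq> ?I \<and> card X = c. row_monomial v (slot_count (?I - X)) (slot_count X) g)"
  proof -
    have "{X. X \<subseteq> ?I \<and> card X = c} = {X \<in> Pow ?I. card X = c}" by auto
    then show ?thesis by (simp add: sum.inter_filter del: Pow_iff)
  qed
  finally show ?thesis by (simp add: polar_def x_def y_def)
qed

text \<open>
  All terms of the expansion have the same total exponent, hence agree modulo the next layer, and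
  they are counted by a binomial coefficient.
\<close>

lemma polar_mod_next:
  fixes v :: "'k::field^'n::finite^2"
  assumes pr: "(p, r) \<in> layer_exponents b a1 a2 k" and q: "\<And>j. q j = p j + r j"
  shows "(\<lambda>g. det g ^ Suc k * polar v q (a2 - k) g) -
      (\<lambda>g. of_nat (sum q UNIV choose (a2 - k)) * layer_gen v k p r g) \<in> layer v b a1 a2 (Suc k)"
proof -
  let ?S = "{X. X \<subseteq> factor_slots q \<and> card X = a2 - k}"
  let ?F = "\<lambda>X. layer_gen v k (slot_count (factor_slots q - X)) (slot_count X)"
  have fin: "finite ?S" by simp
  have "?F X - layer_gen v k p r \<in> layer v b a1 a2 (Suc k)" if X: "X \<in> ?S" for X
  proof (rule layer_gen_cong_mod_next[OF _ pr])
    have finX: "finite X" using X finite_subset[OF _ finite_factor_slots] by blast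
    have c: "slot_count (factor_slots q - X) j + slot_count X j = p j + r j" for j
      using slot_count_complement[of X q j] X q by simp
    show "slot_count (factor_slots q - X) j + slot_count X j = p j + r j" for j by (rule c)
    have s2: "sum (slot_count X) UNIV + k = a2"
      using X pr sum_slot_count[OF finX] by (auto simp: layer_exponents_def)
    have "sum (slot_count (factor_slots q - X)) UNIV + sum (slot_count X) UNIV = sum p UNIV + sum r UNIV"
      using c by (simp flip: sum.distrib)
    then have s1: "sum (slot_count (factor_slots q - X)) UNIV + k = a1"
      using s2 pr by (auto simp: layer_exponents_def)
    show "(slot_count (factor_slots q - X), slot_count X) \<in> layer_exponents b a1 a2 k"
      using s1 s2 c pr by (auto simp: layer_exponents_def)
  qed
  then have "(\<Sum>X\<in>?S. ?F X - layer_gen v k p r) \<in> layer v b a1 a2 (Suc k)"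
    by (rule fs.subspace_sum[OF layer_subspace])
  moreover have "(\<Sum>X\<in>?S. ?F X - layer_gen v k p r) = (\<lambda>g. det g ^ Suc k * polar v q (a2 - k) g) -
      (\<lambda>g. of_nat (sum q UNIV choose (a2 - k)) * layer_gen v k p r g)"
  proof
    fix g
    have "card ?S = (sum q UNIV choose (a2 - k))"
      using n_subsets[OF finite_factor_slots, of q "a2 - k"] by (simp add: card_factor_slots)
    then show "(\<Sum>X\<in>?S. ?F X - layer_gen v k p r) g = ((\<lambda>g. det g ^ Suc k * polar v q (a2 - k) g) -
      (\<lambda>g. of_nat (sum q UNIV choose (a2 - k)) * layer_gen v k p r g)) g"
      by (simp add: sum_fun_apply sum_subtractf polar_expansion sum_distrib_left layer_gen_def)
  qed
  ultimately show ?thesis by simp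
qed

section \<open>Restriction to a line\<close>

text \<open>
  The restriction of $\ell_j$ to the line $(1, 0) + s (c, 1)$, as a polynomial in \<open>s\<close>.
\<close>

definition line_form :: "'k::field^'n^2 \<Rightarrow> 'k \<Rightarrow> 'n \<Rightarrow> 'k poly" where
  "line_form v c j = [:v $ 1 $ j, c * v $ 1 $ j + v $ 2 $ j:]"

abbreviation line_product :: "'k::field^'n::finite^2 \<Rightarrow> 'k \<Rightarrow> ('n \<Rightarrow> nat) \<Rightarrow> 'k poly" where
  "line_product v c q \<equiv> (\<Prod>j\<in>UNIV. line_form v c j ^ q j)"

text \<open>
  No column is zero, so each column excludes at most one direction \<open>(c, 1)\<close>; for the other
  directions every restricted form has degree exactly one.
\<close>

lemma exists_transversal_line:
  fixes v :: "'k::field_char_0^'n::finite^2"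
  assumes "uniform_rank2 v"
  shows "\<exists>c. \<forall>j. c * v $ 1 $ j + v $ 2 $ j \<noteq> 0"
proof -
  have "infinite (UNIV :: 'k set)" by (rule infinite_UNIV_char_0)
  then obtain c where c: "c \<notin> (\<lambda>j. - v $ 2 $ j / v $ 1 $ j) ` UNIV"
    using ex_new_if_finite[of "(\<lambda>j. - v $ 2 $ j / v $ 1 $ j) ` UNIV"] by auto
  have "c * v $ 1 $ j + v $ 2 $ j \<noteq> 0" for j
  proof
    assume 0: "c * v $ 1 $ j + v $ 2 $ j = 0"
    have "\<exists>l. l \<noteq> j"
    proof (rule ccontr)
      assume "\<nexists>l. l \<noteq> j"
      then have "(UNIV :: 'n set) = {j}" by auto
      then have "CARD('n) = 1" by (metis card_1_singleton_iff One_nat_def)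
      then show False using assms by (simp add: uniform_rank2_def)
    qed
    then obtain l where "l \<noteq> j" ..
    then have m: "minor v l j \<noteq> 0" by (rule minor_nonzero[OF assms])
    show False
    proof (cases "v $ 1 $ j = 0")
      case True
      then show False using 0 m by (simp add: minor_def)
    next
      case False
      then have "c = - v $ 2 $ j / v $ 1 $ j" using 0 by (simp add: field_simps eq_neg_iff_add_eq_0)
      then show False using c by blast
    qed
  qed
  then show ?thesis by blast
qed

text \<open>
  The sums \<open>p + r\<close> of exponents in layer \<open>k\<close>.
\<close>

definition layer_totals :: "('n::finite \<Rightarrow> nat) \<Rightarrow> nat \<Rightarrow> ('n \<Rightarrow> nat) set" where
  "layer_totals b k = {q. (\<forall>j. q j \<le> b j \<and> b j \<le> q j + k) \<and> sum q UNIV + 2 * k = sum b UNIV}"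

lemma sum_split_min: "(\<Sum>j\<in>UNIV. b j - k) + (\<Sum>j\<in>UNIV. min (b j) k) = sum b UNIV"
  for b :: "'n::finite \<Rightarrow> nat"
  by (subst sum.distrib[symmetric], rule sum.cong) auto

text \<open>
  Every product in question is divisible by $\prod_j \ell_j^{\max(0, b_j - k)}$, and the quotient has
  degree \<open>e\<close>. The remaining multiplicities \<open>min (b j) k\<close> add up to \<open>e + 2 * k\<close>; listing these
  factors in blocks, factors at least \<open>k\<close> places apart have different roots, so the products of
  \<open>e\<close> factors around a window of length \<open>k\<close> are a basis of the polynomials of degree at most \<open>e\<close>.
\<close>

lemma line_products_basis:
  fixes v :: "'k::field_char_0^'n::finite^2"
  assumes v: "uniform_rank2 v" and c: "\<And>j. c * v $ 1 $ j + v $ 2 $ j \<noteq> 0"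
    and e: "(\<Sum>j\<in>UNIV. min (b j) k) = e + 2 * k"
  shows "\<exists>Q. (\<forall>i\<le>e. Q i \<in> layer_totals b k) \<and>
    (\<forall>\<alpha>. (\<Sum>i\<le>e. smult (\<alpha> i) (line_product v c (Q i))) = 0 \<longrightarrow> (\<forall>i\<le>e. \<alpha> i = 0)) \<and>
    (\<forall>q\<in>layer_totals b k. \<exists>\<alpha>. line_product v c q = (\<Sum>i\<le>e. smult (\<alpha> i) (line_product v c (Q i))))"
proof -
  define \<beta> where "\<beta> j = min (b j) k" for j
  have s: "sum \<beta> UNIV = e + 2 * k" using e by (simp add: \<beta>_def)
  obtain \<sigma> :: "nat \<Rightarrow> 'n" where \<sigma>: "\<And>j. card {t. t < e + 2 * k \<and> \<sigma> t = j} = \<beta> j"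
    "\<And>s t. s < t \<Longrightarrow> t < e + 2 * k \<Longrightarrow> \<sigma> s = \<sigma> t \<Longrightarrow> t - s < \<beta> (\<sigma> t)"
    using blockwise_enumeration[of UNIV \<beta>] unfolding s by auto
  define T where "T i = {..<i} \<union> {i + k..<e + k}" for i
  define Q where "Q i j = (b j - k) + card {t \<in> T i. \<sigma> t = j}" for i j
  define L where "L t = line_form v c (\<sigma> t)" for t
  define M where "M t = L (t + k)" for t
  define \<rho> where "\<rho> t = - v $ 1 $ (\<sigma> (t + k)) / (c * v $ 1 $ (\<sigma> (t + k)) + v $ 2 $ (\<sigma> (t + k)))" for t
  define B where "B = line_product v c (\<lambda>j. b j - k)"
  \<comment> \<open>\<open>Q i\<close> omits the places \<open>i, \<dots>, i + k - 1\<close> of the list; \<open>\<rho> t\<close> is the root of \<open>M t\<close>.\<close>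
  have form_nz: "line_form v c j \<noteq> 0" for j using c[of j] by (simp add: line_form_def)
  then have B: "B \<noteq> 0" by (simp add: B_def)
  have deg: "degree (line_form v c j) = 1" for j using c[of j] by (simp add: line_form_def)
  have finT: "finite (T i)" for i by (simp add: T_def)
  have prodQ: "line_product v c (Q i) = B * window_prod L M e i" if "i \<le> e" for i
  proof -
    have "line_product v c (Q i) = B * (\<Prod>t\<in>T i. L t)"
      by (simp add: Q_def power_add prod.distrib B_def L_def prod_card_fibres[OF finT])
    also have "(\<Prod>t\<in>T i. L t) = (\<Prod>t<i. L t) * (\<Prod>t\<in>{i + k..<e + k}. L t)"
      unfolding T_def by (rule prod.union_disjoint) auto
    also have "(\<Prod>t\<in>{i + k..<e + k}. L t) = (\<Prod>t\<in>{i..<e}. M t)"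
      unfolding M_def by (rule prod.shift_bounds_nat_ivl)
    finally show ?thesis by (simp only: window_prod_def)
  qed
  have root: "poly (M t) (\<rho> t) = 0" for t
    using c[of "\<sigma> (t + k)"] by (simp add: M_def L_def line_form_def \<rho>_def field_simps)
  have noroot: "poly (L s) (\<rho> t) \<noteq> 0" if st: "s \<le> t" "t < e" for s t
  proof
    assume 0: "poly (L s) (\<rho> t) = 0"
    have "k \<noteq> 0"
    proof
      assume "k = 0"
      then have "e = 0" using e by simp
      then show False using st by simp
    qed
    then have "\<sigma> s \<noteq> \<sigma> (t + k)" using \<sigma>(2)[of s "t + k"] st by (auto simp: \<beta>_def)
    then have m: "minor v (\<sigma> s) (\<sigma> (t + k)) \<noteq> 0" by (rule minor_nonzero[OF v])
    have "poly (L s) (\<rho> t) * (c * v $ 1 $ (\<sigma> (t + k)) + v $ 2 $ (\<sigma> (t + k))) = minor v (\<sigma> s) (\<sigma> (t + k))"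
      using c[of "\<sigma> (t + k)"] by (simp add: L_def line_form_def \<rho>_def minor_def divide_simps) (simp add: algebra_simps)
    then show False using m 0 by simp
  qed
  have "Q i \<in> layer_totals b k" if "i \<le> e" for i
  proof -
    have Ts: "T i \<subseteq> {..<e + 2 * k}" using that by (auto simp: T_def)
    have le: "card {t \<in> T i. \<sigma> t = j} \<le> \<beta> j" for j
      unfolding \<sigma>(1)[symmetric] by (rule card_mono) (use Ts in auto)
    have "card (T i) = card {..<i} + card {i + k..<e + k}"
      unfolding T_def by (rule card_Un_disjoint) auto
    then have "card (T i) = e" using that by simp
    then have "sum (Q i) UNIV = (\<Sum>j\<in>UNIV. b j - k) + e"
      unfolding Q_def by (simp add: sum.distrib sum_card_fibres[OF finT])
    then have "sum (Q i) UNIV + 2 * k = sum b UNIV"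
      using e sum_split_min[of b k] by simp
    moreover have "Q i j \<le> b j" "b j \<le> Q i j + k" for j
      using le[of j] by (auto simp: Q_def \<beta>_def)
    ultimately show ?thesis by (simp add: layer_totals_def)
  qed
  moreover have "\<forall>i\<le>e. \<alpha> i = 0" if "(\<Sum>i\<le>e. smult (\<alpha> i) (line_product v c (Q i))) = 0" for \<alpha>
  proof (rule window_prods_independent[where L = L and M = M and \<rho> = \<rho>])
    have "(\<Sum>i\<le>e. smult (\<alpha> i) (line_product v c (Q i))) = B * (\<Sum>i\<le>e. smult (\<alpha> i) (window_prod L M e i))"
      unfolding sum_distrib_left by (intro sum.cong refl) (simp add: prodQ)
    then show "(\<Sum>i\<le>e. smult (\<alpha> i) (window_prod L M e i)) = 0" using that B by simp
  qed (use root noroot form_nz in \<open>auto simp: M_def L_def\<close>)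
  moreover have "\<exists>\<alpha>. line_product v c q = (\<Sum>i\<le>e. smult (\<alpha> i) (line_product v c (Q i)))"
    if q: "q \<in> layer_totals b k" for q
  proof -
    let ?F = "line_product v c (\<lambda>j. q j - (b j - k))"
    have le: "b j - k \<le> q j" for j using q by (auto simp: layer_totals_def le_diff_conv)
    have qF: "line_product v c q = B * ?F"
      unfolding B_def prod.distrib[symmetric] power_add[symmetric] using le by simp
    have "degree ?F \<le> (\<Sum>j\<in>UNIV. degree (line_form v c j ^ (q j - (b j - k))))"
      by (rule order.trans[OF degree_prod_sum_le]) (auto simp: comp_def)
    also have "\<dots> \<le> (\<Sum>j\<in>UNIV. q j - (b j - k))"
      by (intro sum_mono order.trans[OF degree_power_le]) (simp add: deg)
    also have "\<dots> = sum q UNIV - (\<Sum>j\<in>UNIV. b j - k)"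
      by (rule sum_subtractf_nat) (use le in auto)
    also have "\<dots> = e"
      using q e sum_split_min[of b k] by (auto simp: layer_totals_def)
    finally have "\<exists>\<alpha>. ?F = (\<Sum>i\<le>e. smult (\<alpha> i) (window_prod L M e i))"
      by (intro window_prods_span[where \<rho> = \<rho>]) (use root noroot deg in \<open>auto simp: M_def L_def\<close>)
    then obtain \<alpha> where \<alpha>: "?F = (\<Sum>i\<le>e. smult (\<alpha> i) (window_prod L M e i))" ..
    have "line_product v c q = (\<Sum>i\<le>e. smult (\<alpha> i) (line_product v c (Q i)))"
      unfolding qF \<alpha> sum_distrib_left by (intro sum.cong refl) (simp add: prodQ)
    then show ?thesis by (intro exI[of _ \<alpha>])
  qed
  ultimately show ?thesis by blast
qed

lemma mat_mult_entry: "(g ** v) $ i $ j = g $ i $ 1 * v $ 1 $ j + g $ i $ 2 * v $ 2 $ j"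
  for g :: "'k::comm_ring_1^2^2"
  by (simp add: matrix_matrix_mult_def sum_2)

text \<open>
  A relation on the line extends by homogeneity to all points $g_1 + \epsilon g_2$ outside the
  direction of the line. As \<open>g\<close> is invertible, only one $\epsilon$ is excluded, so the relation is
  an identity of polynomials in $\epsilon$ and holds for their coefficients.
\<close>

lemma polar_lincomb:
  fixes v :: "'k::field_char_0^'n::finite^2"
  assumes g: "det g \<noteq> 0" and rel: "line_product v c q = (\<Sum>i\<in>I. smult (\<alpha> i) (line_product v c (Q i)))"
    and tot: "\<And>i. i \<in> I \<Longrightarrow> sum (Q i) UNIV = sum q UNIV"
  shows "polar v q a g = (\<Sum>i\<in>I. \<alpha> i * polar v (Q i) a g)"
proof -
  define A where "A q = (\<Prod>j\<in>UNIV. [:(g ** v) $ 1 $ j, (g ** v) $ 2 $ j:] ^ q j)" for q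
  define \<Xi> where "\<Xi> = [:g $ 1 $ 1 - c * g $ 1 $ 2, g $ 2 $ 1 - c * g $ 2 $ 2:]"
  have "\<Xi> \<noteq> 0"
  proof
    assume "\<Xi> = 0"
    then have "g $ 1 $ 1 = c * g $ 1 $ 2" "g $ 2 $ 1 = c * g $ 2 $ 2" by (auto simp: \<Xi>_def)
    then show False using g by (simp add: det_2)
  qed
  \<comment> \<open>In the basis \<open>(1, 0)\<close>, \<open>(c, 1)\<close> of the plane, the point $g_1 + \epsilon g_2$ has first
    coordinate \<open>poly \<Xi> \<epsilon>\<close>, so it is this multiple of a point of the line.\<close>
  have homog: "poly (A q) \<epsilon> = poly \<Xi> \<epsilon> ^ sum q UNIV * poly (line_product v c q) ((g $ 1 $ 2 + \<epsilon> * g $ 2 $ 2) / poly \<Xi> \<epsilon>)"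
    if "poly \<Xi> \<epsilon> \<noteq> 0" for \<epsilon> q
  proof -
    have "poly [:(g ** v) $ 1 $ j, (g ** v) $ 2 $ j:] \<epsilon> =
        poly \<Xi> \<epsilon> * poly (line_form v c j) ((g $ 1 $ 2 + \<epsilon> * g $ 2 $ 2) / poly \<Xi> \<epsilon>)" for j
    proof -
      have "poly \<Xi> \<epsilon> * poly (line_form v c j) ((g $ 1 $ 2 + \<epsilon> * g $ 2 $ 2) / poly \<Xi> \<epsilon>) =
          poly \<Xi> \<epsilon> * v $ 1 $ j + (g $ 1 $ 2 + \<epsilon> * g $ 2 $ 2) * (c * v $ 1 $ j + v $ 2 $ j)"
        using that by (simp add: line_form_def distrib_left)
      also have "\<dots> = poly [:(g ** v) $ 1 $ j, (g ** v) $ 2 $ j:] \<epsilon>"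
        by (simp add: \<Xi>_def mat_mult_entry algebra_simps)
      finally show ?thesis ..
    qed
    then show ?thesis
      by (simp add: A_def poly_prod poly_power power_mult_distrib prod.distrib power_sum del: poly_pCons)
  qed
  define D where "D = A q - (\<Sum>i\<in>I. smult (\<alpha> i) (A (Q i)))"
  have "poly (D * \<Xi>) \<epsilon> = 0" for \<epsilon>
  proof (cases "poly \<Xi> \<epsilon> = 0")
    case False
    let ?s = "(g $ 1 $ 2 + \<epsilon> * g $ 2 $ 2) / poly \<Xi> \<epsilon>"
    have "poly (\<Sum>i\<in>I. smult (\<alpha> i) (A (Q i))) \<epsilon> =
        (\<Sum>i\<in>I. \<alpha> i * (poly \<Xi> \<epsilon> ^ sum q UNIV * poly (line_product v c (Q i)) ?s))"
      unfolding poly_sum poly_smult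
      by (intro sum.cong refl) (simp only: homog[OF False] tot)
    also have "\<dots> = poly \<Xi> \<epsilon> ^ sum q UNIV * poly (line_product v c q) ?s"
      unfolding rel poly_sum poly_smult sum_distrib_left by (intro sum.cong refl) (simp only: mult_ac)
    also have "\<dots> = poly (A q) \<epsilon>" by (rule homog[OF False, symmetric])
    finally show ?thesis by (simp add: D_def)
  qed simp
  then have "D * \<Xi> = 0" using poly_all_0_iff_0 by blast
  then have "D = 0" using \<open>\<Xi> \<noteq> 0\<close> by simp
  then have "coeff (A q) a = coeff (\<Sum>i\<in>I. smult (\<alpha> i) (A (Q i))) a" by (simp add: D_def)
  then show ?thesis by (simp add: polar_def A_def coeff_sum)
qed

section \<open>Restriction to secants of the line\<close>

text \<open>
  The rows are the points with parameters \<open>s\<close> and \<open>s + \<epsilon>\<close> of the line. The determinant is \<open>\<epsilon>\<close>,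
  so along these matrices the filtration by powers of \<open>det g\<close> is the order of vanishing at \<open>\<epsilon> = 0\<close>.
\<close>

definition secant_matrix :: "'k::field \<Rightarrow> 'k \<Rightarrow> 'k \<Rightarrow> 'k^2^2" where
  "secant_matrix c s \<epsilon> = (\<chi> i. \<chi> l. if i = 1 then (if l = 1 then 1 + s * c else s)
     else (if l = 1 then 1 + (s + \<epsilon>) * c else s + \<epsilon>))"

lemma det_secant_matrix: "det (secant_matrix c s \<epsilon>) = \<epsilon>"
  by (simp add: det_2 secant_matrix_def algebra_simps)

lemma secant_matrix_mult:
  "(secant_matrix c s \<epsilon> ** v) $ 1 $ j = poly (line_form v c j) s"
  "(secant_matrix c s \<epsilon> ** v) $ 2 $ j = poly (line_form v c j) (s + \<epsilon>)"
  by (simp_all add: mat_mult_entry secant_matrix_def line_form_def algebra_simps)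

lemma row_monomial_along_secants:
  fixes v :: "'k::field^'n::finite^2"
  shows "\<exists>A. \<forall>\<epsilon>. row_monomial v p r (secant_matrix c s \<epsilon>) = poly A \<epsilon>"
proof (intro exI allI)
  fix \<epsilon>
  show "row_monomial v p r (secant_matrix c s \<epsilon>) =
      poly (\<Prod>j\<in>UNIV. [:poly (line_form v c j) s ^ p j:] * pcompose (line_form v c j) [:s, 1:] ^ r j) \<epsilon>"
    by (simp add: row_monomial_def secant_matrix_mult poly_prod poly_power poly_pcompose)
qed

lemma polar_along_secants:
  fixes v :: "'k::field^'n::finite^2"
  shows "\<exists>A. \<forall>\<epsilon>. polar v q a (secant_matrix c s \<epsilon>) = poly A \<epsilon>"
proof -
  have "\<forall>X. \<exists>A. \<forall>\<epsilon>. row_monomial v (slot_count (factor_slots q - X)) (slot_count X) (secant_matrix c s \<epsilon>) = poly A \<epsilon>"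
    using row_monomial_along_secants by blast
  from choice[OF this] obtain A where A: "\<forall>X \<epsilon>. row_monomial v (slot_count (factor_slots q - X)) (slot_count X)
     (secant_matrix c s \<epsilon>) = poly (A X) \<epsilon>" ..
  have "polar v q a (secant_matrix c s \<epsilon>) = poly (\<Sum>X | X \<subseteq> factor_slots q \<and> card X = a. A X) \<epsilon>" for \<epsilon>
    unfolding polar_expansion poly_sum using A by (intro sum.cong refl) blast
  then show ?thesis by blast
qed

text \<open>
  When both rows coincide, polarisation gives back the form, up to a binomial coefficient. This is
  nonzero in characteristic zero, so no information about the form is lost.
\<close>

lemma polar_on_diagonal:
  fixes v :: "'k::field^'n::finite^2"
  shows "polar v q a (secant_matrix c s 0) = of_nat (sum q UNIV choose a) * poly (line_product v c q) s"
proof -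
  have "(\<Prod>j\<in>UNIV. [:poly (line_form v c j) s, poly (line_form v c j) s:] ^ q j) =
      (\<Prod>j\<in>UNIV. ([:poly (line_form v c j) s:] * [:1, 1:]) ^ q j)"
    by simp
  also have "\<dots> = (\<Prod>j\<in>UNIV. [:poly (line_form v c j) s ^ q j:]) * [:1, 1:] ^ sum q UNIV"
    by (simp only: power_mult_distrib prod.distrib power_sum poly_const_pow)
  also have "(\<Prod>j\<in>UNIV. [:poly (line_form v c j) s ^ q j:]) = [:poly (line_product v c q) s:]"
  proof -
    have "(\<Prod>j\<in>J. [:f j:]) = [:prod f J:]" for f :: "'n \<Rightarrow> 'k" and J
      by (induction J rule: infinite_finite_induct) (simp_all add: one_pCons)
    then show ?thesis by (simp add: poly_prod poly_power)
  qed
  finally have eq: "(\<Prod>j\<in>UNIV. [:poly (line_form v c j) s, poly (line_form v c j) s:] ^ q j) =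
      [:poly (line_product v c q) s:] * [:1, 1:] ^ sum q UNIV" .
  show ?thesis
  proof -
    have "coeff ([:1, 1 :: 'k:] ^ n) a = of_nat (n choose a)" for n
    proof (cases "a \<le> n")
      case False
      then have "degree ([:1, 1 :: 'k:] ^ n) < a" by (simp add: degree_power_eq)
      then show ?thesis using False by (simp add: coeff_eq_0 binomial_eq_0)
    qed (simp add: coeff_linear_poly_power)
    then show ?thesis by (simp add: polar_def secant_matrix_mult eq)
  qed
qed

lemma layer_along_secants:
  fixes v :: "'k::field^'n::finite^2"
  assumes "F \<in> layer v b a1 a2 k"
  shows "\<exists>A. \<forall>\<epsilon>. F (secant_matrix c s \<epsilon>) = \<epsilon> ^ Suc k * poly A \<epsilon>"
proof -
  let ?V = "{F. \<exists>A. \<forall>\<epsilon>. F (secant_matrix c s \<epsilon>) = \<epsilon> ^ Suc k * poly A \<epsilon>}"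
  have "fs.subspace ?V"
  proof (rule fs.subspaceI)
    show "0 \<in> ?V" by (auto intro!: exI[of _ 0])
    show "F + G \<in> ?V" if "F \<in> ?V" "G \<in> ?V" for F G
    proof -
      from that obtain A B where "\<forall>\<epsilon>. F (secant_matrix c s \<epsilon>) = \<epsilon> ^ Suc k * poly A \<epsilon>"
        "\<forall>\<epsilon>. G (secant_matrix c s \<epsilon>) = \<epsilon> ^ Suc k * poly B \<epsilon>" by blast
      then show ?thesis by (intro CollectI exI[of _ "A + B"]) (simp add: distrib_left)
    qed
    show "(\<lambda>g. x * F g) \<in> ?V" if "F \<in> ?V" for x F
    proof -
      from that obtain A where "\<forall>\<epsilon>. F (secant_matrix c s \<epsilon>) = \<epsilon> ^ Suc k * poly A \<epsilon>" by blast
      then show ?thesis by (intro CollectI exI[of _ "smult x A"]) simp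
    qed
  qed
  moreover have "layer_gen v k p r \<in> ?V" for p r
  proof -
    obtain A where "\<forall>\<epsilon>. row_monomial v p r (secant_matrix c s \<epsilon>) = poly A \<epsilon>"
      using row_monomial_along_secants by blast
    then show ?thesis by (intro CollectI exI[of _ A]) (simp add: layer_gen_def det_secant_matrix)
  qed
  ultimately have "layer v b a1 a2 k \<subseteq> ?V"
    unfolding layer_def by (intro fs.span_minimal) auto
  then show ?thesis using assms by blast
qed

section \<open>Dimensions of the layers\<close>

text \<open>
  Used to distribute a total exponent to the two rows in prescribed degrees.
\<close>

lemma exists_below_with_sum:
  fixes q :: "'n::finite \<Rightarrow> nat"
  assumes "m \<le> sum q UNIV"
  shows "\<exists>p. (\<forall>j. p j \<le> q j) \<and> sum p UNIV = m"
  using assms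
proof (induction m)
  case 0
  show ?case by (intro exI[of _ "\<lambda>_. 0"]) simp
next
  case (Suc m)
  then obtain p where p: "\<And>j. p j \<le> q j" "sum p UNIV = m" by auto
  have "\<exists>j. p j < q j"
  proof (rule ccontr)
    assume "\<nexists>j. p j < q j"
    then have "sum q UNIV \<le> sum p UNIV" by (intro sum_mono) (simp add: not_less)
    then show False using Suc.prems p(2) by simp
  qed
  then obtain j where j: "p j < q j" ..
  have "\<forall>l. incr p j l \<le> q l" using p(1) j by (auto simp: Suc_le_eq)
  then show ?case using p(2) sum_incr[of p j] by blast
qed

definition layer_dim :: "('n::finite \<Rightarrow> nat) \<Rightarrow> nat \<Rightarrow> nat" where
  "layer_dim b k = nat (1 - 2 * int k + (\<Sum>j\<in>UNIV. int (min (b j) k)))"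

text \<open>
  The polarisations of a basis of the forms belonging to layer \<open>k\<close> span that layer modulo the
  next one, because generators are congruent to multiples of polarisations and polarisation is linear.
  They are independent modulo the next layer: a combination in the next layer vanishes at
  \<open>\<epsilon> = 0\<close> to higher order along secants, so its leading coefficient, the same combination of
  the forms on the line, is zero. When \<open>2 * k\<close> exceeds the sum of the \<open>min (b j) k\<close>, the layer and
  the next one are zero.
\<close>

lemma layer_dim_step:
  fixes v :: "'k::field_char_0^'n::finite^2"
  assumes v: "uniform_rank2 v" and a: "a1 + a2 = sum b UNIV" and k: "k \<le> a1" "k \<le> a2"
    and N: "has_dim (layer v b a1 a2 (Suc k)) N"
  shows "has_dim (layer v b a1 a2 k) (layer_dim b k + N)"
proof (cases "2 * k \<le> (\<Sum>j\<in>UNIV. min (b j) k)")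
  case False
  have empty: "layer_exponents b a1 a2 k = {}"
  proof -
    have False if pr: "(p, r) \<in> layer_exponents b a1 a2 k" for p r
    proof -
      have "b j - k \<le> p j + r j" for j using pr by (auto simp: layer_exponents_def le_diff_conv)
      then have "(\<Sum>j\<in>UNIV. b j - k) \<le> (\<Sum>j\<in>UNIV. p j + r j)" by (intro sum_mono)
      then show False using False pr a sum_split_min[of b k]
        by (auto simp: layer_exponents_def sum.distrib)
    qed
    then show ?thesis by auto
  qed
  then have "layer v b a1 a2 k = {0}" by (simp add: layer_def)
  moreover have "layer v b a1 a2 (Suc k) = {0}"
    using layer_Suc_subset[OF v a, of k] calculation fs.subspace_0[OF layer_subspace, of v b a1 a2 "Suc k"] by auto
  moreover have "layer_dim b k = 0"
    using False by (simp add: layer_dim_def flip: of_nat_sum)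
  ultimately show ?thesis using N by simp
next
  case True
  then obtain e where e: "(\<Sum>j\<in>UNIV. min (b j) k) = e + 2 * k" by (metis le_add_diff_inverse2)
  have dim: "layer_dim b k = Suc e"
    using e by (simp add: layer_dim_def flip: of_nat_sum)
  obtain c where c: "\<And>j. c * v $ 1 $ j + v $ 2 $ j \<noteq> 0" using exists_transversal_line[OF v] by blast
  obtain Q where Q: "\<And>i. i \<le> e \<Longrightarrow> Q i \<in> layer_totals b k"
    and indep: "\<And>\<alpha> i. (\<Sum>i\<le>e. smult (\<alpha> i) (line_product v c (Q i))) = 0 \<Longrightarrow> i \<le> e \<Longrightarrow> \<alpha> i = 0"
    and spans: "\<And>q. q \<in> layer_totals b k \<Longrightarrow> \<exists>\<alpha>. line_product v c q = (\<Sum>i\<le>e. smult (\<alpha> i) (line_product v c (Q i)))"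
    using line_products_basis[OF v c e] by blast
  let ?L = "layer v b a1 a2"
  define C :: 'k where "C = of_nat ((a1 - k + (a2 - k)) choose (a2 - k))"
  have C: "C \<noteq> 0" by (simp add: C_def)
  have tot: "sum q UNIV = a1 - k + (a2 - k)" if "q \<in> layer_totals b k" for q
    using that a k by (auto simp: layer_totals_def)
  define P where "P q = (\<lambda>g. det g ^ Suc k * polar v q (a2 - k) g)" for q
  have P_mod: "P q - (\<lambda>g. C * layer_gen v k p r g) \<in> ?L (Suc k)"
    if "(p, r) \<in> layer_exponents b a1 a2 k" "\<And>j. q j = p j + r j" "q \<in> layer_totals b k" for p q r
    using polar_mod_next[OF that(1,2), of v] unfolding tot[OF that(3)] P_def C_def .
  have P_mem: "P q \<in> ?L k" if q: "q \<in> layer_totals b k" for q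
  proof -
    obtain p where p: "\<And>j. p j \<le> q j" "sum p UNIV = a1 - k"
      using exists_below_with_sum[of "a1 - k" q] tot[OF q] by auto
    define r where "r j = q j - p j" for j
    have qpr: "q j = p j + r j" for j using p(1)[of j] by (simp add: r_def)
    then have "sum q UNIV = sum p UNIV + sum r UNIV" by (simp add: sum.distrib)
    then have pr: "(p, r) \<in> layer_exponents b a1 a2 k"
      using q p(2) tot[OF q] k unfolding layer_exponents_def layer_totals_def by (auto simp: qpr)
    have "P q - (\<lambda>g. C * layer_gen v k p r g) \<in> ?L k"
      using P_mod[OF pr qpr q] layer_Suc_subset[OF v a] by blast
    moreover have "(\<lambda>g. C * layer_gen v k p r g) \<in> ?L k"
      by (intro fs.subspace_scale[OF layer_subspace] layer_gen_in_layer pr)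
    ultimately have "(P q - (\<lambda>g. C * layer_gen v k p r g)) + (\<lambda>g. C * layer_gen v k p r g) \<in> ?L k"
      by (rule fs.subspace_add[OF layer_subspace])
    then show ?thesis by (simp only: diff_add_cancel)
  qed
  define X where "X i = P (Q i)" for i
  have "has_dim (fs.span (X ` {..<Suc e} \<union> ?L (Suc k))) (Suc e + N)"
  proof (rule has_dim_extend[OF N layer_subspace])
    fix \<alpha> assume mem: "(\<lambda>x. \<Sum>i<Suc e. \<alpha> i * X i x) \<in> ?L (Suc k)"
    have "poly (\<Sum>i\<le>e. smult (\<alpha> i) (line_product v c (Q i))) s = 0" for s
    proof -
      let ?g = "secant_matrix c s"
      obtain A where A: "\<And>\<epsilon>. (\<Sum>i<Suc e. \<alpha> i * X i (?g \<epsilon>)) = \<epsilon> ^ Suc (Suc k) * poly A \<epsilon>"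
        using layer_along_secants[OF mem, of c s] by blast
      have "\<forall>i. \<exists>B. \<forall>\<epsilon>. polar v (Q i) (a2 - k) (?g \<epsilon>) = poly B \<epsilon>"
        using polar_along_secants by blast
      from choice[OF this] obtain B where B: "\<And>i \<epsilon>. polar v (Q i) (a2 - k) (?g \<epsilon>) = poly (B i) \<epsilon>" by blast
      define S where "S = (\<Sum>i\<le>e. smult (\<alpha> i) (B i))"
      have "poly ([:0, 1:] ^ Suc k * (S - [:0, 1:] * A)) \<epsilon> = 0" for \<epsilon>
      proof -
        have "\<epsilon> ^ Suc k * poly S \<epsilon> = (\<Sum>i<Suc e. \<alpha> i * X i (?g \<epsilon>))"
          by (simp only: S_def X_def P_def det_secant_matrix B poly_sum poly_smult lessThan_Suc_atMost
              sum_distrib_left mult.left_commute)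
        then show ?thesis unfolding A by (simp add: algebra_simps)
      qed
      then have "[:0, 1:] ^ Suc k * (S - [:0, 1:] * A) = 0" using poly_all_0_iff_0 by blast
      then have "S = [:0, 1:] * A" by (simp only: mult_eq_0_iff power_eq_0_iff) simp
      then have "poly S 0 = 0" by simp
      moreover have "poly S 0 = C * poly (\<Sum>i\<le>e. smult (\<alpha> i) (line_product v c (Q i))) s"
      proof -
        have "poly (B i) 0 = C * poly (line_product v c (Q i)) s" if "i \<le> e" for i
          unfolding B[symmetric] polar_on_diagonal C_def tot[OF Q[OF that]] ..
        then show ?thesis
          unfolding S_def poly_sum poly_smult sum_distrib_left by (intro sum.cong refl) simp
      qed
      ultimately show ?thesis using C by simp
    qed
    then have "(\<Sum>i\<le>e. smult (\<alpha> i) (line_product v c (Q i))) = 0" using poly_all_0_iff_0 by blast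
    then show "\<forall>i<Suc e. \<alpha> i = 0" using indep[of \<alpha>] by (simp add: less_Suc_eq_le)
  qed
  moreover have "fs.span (X ` {..<Suc e} \<union> ?L (Suc k)) = ?L k"
  proof
    have "X ` {..<Suc e} \<subseteq> ?L k" using P_mem Q by (auto simp: X_def less_Suc_eq_le)
    then show "fs.span (X ` {..<Suc e} \<union> ?L (Suc k)) \<subseteq> ?L k"
      using layer_Suc_subset[OF v a] by (intro fs.span_minimal layer_subspace Un_least)
    let ?S = "fs.span (X ` {..<Suc e} \<union> ?L (Suc k))"
    have gen: "layer_gen v k p r \<in> ?S" if pr: "(p, r) \<in> layer_exponents b a1 a2 k" for p r
    proof -
      define q where "q j = p j + r j" for j
      have q: "q \<in> layer_totals b k"
        using pr a k by (auto simp: layer_exponents_def layer_totals_def q_def sum.distrib)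
      obtain \<alpha> where \<alpha>: "line_product v c q = (\<Sum>i\<le>e. smult (\<alpha> i) (line_product v c (Q i)))"
        using spans[OF q] ..
      have "P q = (\<Sum>i\<le>e. (\<lambda>g. \<alpha> i * X i g))"
      proof
        fix g
        show "P q g = (\<Sum>i\<le>e. (\<lambda>g. \<alpha> i * X i g)) g"
        proof (cases "det g = 0")
          case False
          then have "polar v q (a2 - k) g = (\<Sum>i\<in>{..e}. \<alpha> i * polar v (Q i) (a2 - k) g)"
            by (rule polar_lincomb[OF _ \<alpha>]) (use Q tot q in auto)
          then show ?thesis
            by (simp add: P_def X_def sum_fun_apply sum_distrib_left mult.left_commute)
        qed (simp add: P_def X_def sum_fun_apply)
      qed
      also have "\<dots> \<in> ?S"
        by (intro fs.span_sum fs.span_scale fs.span_base UnI1 imageI) simp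
      finally have 1: "P q \<in> ?S" .
      have 2: "P q - (\<lambda>g. C * layer_gen v k p r g) \<in> ?S"
        by (intro fs.span_base UnI2 P_mod[OF pr _ q]) (simp add: q_def)
      have "layer_gen v k p r = (\<lambda>g. inverse C * (P q - (P q - (\<lambda>g. C * layer_gen v k p r g))) g)"
        using C by (simp add: fun_eq_iff)
      also have "\<dots> \<in> ?S" by (intro fs.span_scale fs.span_diff 1 2)
      finally show ?thesis .
    qed
    show "?L k \<subseteq> ?S"
      unfolding layer_def[of v b a1 a2 k] by (rule fs.span_minimal) (use gen in \<open>auto intro: fs.subspace_span\<close>)
  qed
  ultimately show ?thesis using dim by simp
qed

lemma has_dim_layer:
  fixes v :: "'k::field_char_0^'n::finite^2"
  assumes v: "uniform_rank2 v" and a: "a1 + a2 = sum b UNIV" and "k \<le> Suc (min a1 a2)"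
  shows "has_dim (layer v b a1 a2 k) (\<Sum>l\<in>{k..<Suc (min a1 a2)}. layer_dim b l)"
  using assms(3)
proof (induction k rule: inc_induct)
  case base
  have "layer_exponents b a1 a2 (Suc (min a1 a2)) = {}" by (auto simp: layer_exponents_def)
  then have "layer v b a1 a2 (Suc (min a1 a2)) = fs.span {}" by (simp add: layer_def)
  then show ?case unfolding has_dim_def using fs.independent_empty by (intro exI[of _ "{}"]) simp
next
  case (step k)
  then have "k \<le> a1" "k \<le> a2" by auto
  from layer_dim_step[OF v a this step.IH] show ?case
    unfolding sum.atLeast_Suc_lessThan[OF step.hyps(2)] .
qed

section \<open>The Hilbert function of the orbit closure\<close>

definition rows_monom :: "('n \<Rightarrow> nat) \<Rightarrow> ('n \<Rightarrow> nat) \<Rightarrow> (2, 'n::finite) monom" where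
  "rows_monom p r = Abs_poly_mapping (\<lambda>(i, j). if i = 1 then p j else r j)"

lemma lookup_rows_monom: "Poly_Mapping.lookup (rows_monom p r) (i, j) = (if i = 1 then p j else r j)"
  by (simp add: rows_monom_def)

lemma monom_deg_rows:
  fixes m :: "(2, 'n::finite) monom"
  shows "monom_deg m = d \<longleftrightarrow>
    (int (\<Sum>j\<in>UNIV. Poly_Mapping.lookup m (1, j)) = fst d $ 1 \<and>
     int (\<Sum>j\<in>UNIV. Poly_Mapping.lookup m (2, j)) = fst d $ 2 \<and>
     (\<forall>j. int (Poly_Mapping.lookup m (1, j) + Poly_Mapping.lookup m (2, j)) = snd d $ j))"
  by (auto simp: monom_deg_def prod_eq_iff vec_eq_iff forall_2 sum_2)

lemma eval_mat_rows:
  fixes v :: "'k::field^'n::finite^2"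
  shows "eval_mat (g ** v) f = (\<Sum>m\<in>Poly_Mapping.keys f. Poly_Mapping.lookup f m *
    row_monomial v (\<lambda>j. Poly_Mapping.lookup m (1, j)) (\<lambda>j. Poly_Mapping.lookup m (2, j)) g)"
  by (simp add: eval_mat_def row_monomial_def UNIV_2 prod.distrib)

lemma twisted_eval_image:
  fixes v :: "'k::field^'n::finite^2"
  assumes d: "fst d $ 1 = int a1" "fst d $ 2 = int a2" "\<And>j. snd d $ j = int (b j)"
  shows "twisted_eval v ` graded_piece d = layer v b a1 a2 0"
proof
  have deg: "monom_deg m = d \<longleftrightarrow>
      ((\<lambda>j. Poly_Mapping.lookup m (1, j)), (\<lambda>j. Poly_Mapping.lookup m (2, j))) \<in> layer_exponents b a1 a2 0" for m
    unfolding monom_deg_rows d layer_exponents_def of_nat_eq_iff by (auto intro: order.antisym)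
  show "twisted_eval v ` graded_piece d \<subseteq> layer v b a1 a2 0"
  proof (rule image_subsetI)
    fix f :: "('k, 2, 'n) mat_poly" assume f: "f \<in> graded_piece d"
    have "twisted_eval v f = (\<Sum>m\<in>Poly_Mapping.keys f. (\<lambda>g. Poly_Mapping.lookup f m *
       layer_gen v 0 (\<lambda>j. Poly_Mapping.lookup m (1, j)) (\<lambda>j. Poly_Mapping.lookup m (2, j)) g))"
      by (simp add: fun_eq_iff sum_fun_apply twisted_eval_def eval_mat_rows layer_gen_def sum_distrib_left
          mult.left_commute)
    also have "\<dots> \<in> layer v b a1 a2 0"
      using f deg by (intro fs.subspace_sum[OF layer_subspace] fs.subspace_scale[OF layer_subspace] layer_gen_in_layer)
        (auto simp: graded_piece_def)
    finally show "twisted_eval v f \<in> layer v b a1 a2 0" .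
  qed
  have sub: "fs.subspace (twisted_eval v ` graded_piece d)"
  proof (rule fs.subspaceI)
    show "0 \<in> twisted_eval v ` graded_piece d"
      by (rule image_eqI[OF _ graded_piece_closed(1)]) (simp add: fun_eq_iff twisted_eval_def eval_mat_def)
    show "F + G \<in> twisted_eval v ` graded_piece d"
      if FG: "F \<in> twisted_eval v ` graded_piece d" "G \<in> twisted_eval v ` graded_piece d" for F G
    proof -
      from FG obtain f g where "f \<in> graded_piece d" "F = twisted_eval v f" "g \<in> graded_piece d" "G = twisted_eval v g"
        by blast
      then show ?thesis
        by (intro image_eqI[of _ _ "f + g"] graded_piece_closed(2))
          (simp_all add: fun_eq_iff twisted_eval_def eval_mat_add distrib_left)
    qed
    show "(\<lambda>g. x * F g) \<in> twisted_eval v ` graded_piece d" if F: "F \<in> twisted_eval v ` graded_piece d" for x F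
    proof -
      from F obtain f where "f \<in> graded_piece d" "F = twisted_eval v f" by blast
      then show ?thesis
        by (intro image_eqI[of _ _ "Poly_Mapping.single 0 x * f"] graded_piece_closed(4))
          (simp_all add: fun_eq_iff twisted_eval_def eval_mat_const_mult mult.left_commute)
    qed
  qed
  have "layer_gen v 0 p r \<in> twisted_eval v ` graded_piece d" if pr: "(p, r) \<in> layer_exponents b a1 a2 0" for p r
  proof (rule image_eqI)
    let ?f = "Poly_Mapping.single (rows_monom p r) (1::'k)"
    show "?f \<in> graded_piece d"
      using pr by (simp add: graded_piece_def deg lookup_rows_monom)
    show "layer_gen v 0 p r = twisted_eval v ?f"
      by (simp add: fun_eq_iff layer_gen_def twisted_eval_def eval_mat_rows lookup_rows_monom)
  qed
  then show "layer v b a1 a2 0 \<subseteq> twisted_eval v ` graded_piece d"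
    unfolding layer_def by (intro fs.span_minimal sub) auto
qed

text \<open>
  The sum of the dimensions of the layers in degree \<open>d\<close>, zero outside the degrees of monomials.
\<close>

definition orbit_hilbert :: "(2, 'n::finite) mdeg \<Rightarrow> nat" where
  "orbit_hilbert d = (if 0 \<le> fst d $ 1 \<and> 0 \<le> fst d $ 2 \<and> (\<forall>j. 0 \<le> snd d $ j) \<and>
      fst d $ 1 + fst d $ 2 = (\<Sum>j\<in>UNIV. snd d $ j)
    then \<Sum>k<Suc (min (nat (fst d $ 1)) (nat (fst d $ 2))). layer_dim (\<lambda>j. nat (snd d $ j)) k else 0)"

theorem hilbert_function_orbit_closure:
  fixes v :: "'k::field_char_0^'n::finite^2"
  assumes v: "uniform_rank2 v"
  shows "hilbert_function (vanishing_ideal (matrix_orbit_closure v)) d = orbit_hilbert d"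
proof (rule hilbert_function_eqI)
  define b where "b j = nat (snd d $ j)" for j
  show "has_dim (twisted_eval v ` graded_piece d) (orbit_hilbert d)"
  proof (cases "0 \<le> fst d $ 1 \<and> 0 \<le> fst d $ 2 \<and> (\<forall>j. 0 \<le> snd d $ j) \<and>
      fst d $ 1 + fst d $ 2 = (\<Sum>j\<in>UNIV. snd d $ j)")
    case True
    define a1 a2 where "a1 = nat (fst d $ 1)" and "a2 = nat (fst d $ 2)"
    have d: "fst d $ 1 = int a1" "fst d $ 2 = int a2" "\<And>j. snd d $ j = int (b j)"
      using True by (auto simp: a1_def a2_def b_def)
    have "int (a1 + a2) = int (sum b UNIV)" using True d by simp
    then have a: "a1 + a2 = sum b UNIV" by (simp only: of_nat_eq_iff)
    have "orbit_hilbert d = (\<Sum>k\<in>{0..<Suc (min a1 a2)}. layer_dim b k)"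
      using True unfolding b_def[abs_def] by (simp add: orbit_hilbert_def a1_def a2_def atLeast0LessThan del: sum.lessThan_Suc sum.op_ivl_Suc)
    then show ?thesis using has_dim_layer[OF v a, of 0] twisted_eval_image[OF d, of v] by simp
  next
    case False
    have "graded_piece d = ({0} :: ('k, 2, 'n) mat_poly set)"
    proof -
      have "monom_deg m \<noteq> d" for m :: "(2, 'n) monom"
      proof
        assume "monom_deg m = d"
        then have m: "int (\<Sum>j\<in>UNIV. Poly_Mapping.lookup m (1, j)) = fst d $ 1"
           "int (\<Sum>j\<in>UNIV. Poly_Mapping.lookup m (2, j)) = fst d $ 2"
           "\<And>j. int (Poly_Mapping.lookup m (1, j) + Poly_Mapping.lookup m (2, j)) = snd d $ j"
          unfolding monom_deg_rows by auto
        then show False using False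
          by (auto simp: sum.distrib sum_nonneg simp flip: m)
      qed
      then show ?thesis by (auto simp: graded_piece_def simp flip: keys_eq_empty)
    qed
    then have "twisted_eval v ` graded_piece d = fs.span {}"
      by (simp add: twisted_eval_def eval_mat_def fun_eq_iff)
    moreover have "orbit_hilbert d = 0" using False by (auto simp: orbit_hilbert_def)
    ultimately show ?thesis unfolding has_dim_def using fs.independent_empty by (intro exI[of _ "{}"]) simp
  qed
qed

section \<open>Laurent polynomials acting on series\<close>

text \<open>
  Arbitrary functions on the grading group are formal series, infinite in all directions; Laurent
  polynomials act on them, and this action is compatible with their multiplication.
\<close>

abbreviation series_mult :: "('r::finite, 'n::finite) laurent \<Rightarrow> (('r, 'n) mdeg \<Rightarrow> int) \<Rightarrow> ('r, 'n) mdeg \<Rightarrow> int"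
  (infixr "\<star>" 75) where "P \<star> H \<equiv> laurent_times_series P H"

lemma series_mult_superset:
  assumes "finite K" "Poly_Mapping.keys P \<subseteq> K"
  shows "(P \<star> H) d = (\<Sum>e\<in>K. Poly_Mapping.lookup P e * H (d - e))"
  unfolding laurent_times_series_def
  by (rule sum.mono_neutral_left) (use assms in \<open>auto simp: in_keys_iff\<close>)

lemma series_mult_zero [simp]: "0 \<star> H = (\<lambda>d. 0)"
  by (simp add: laurent_times_series_def fun_eq_iff)

lemma series_mult_single: "Poly_Mapping.single e c \<star> H = (\<lambda>d. c * H (d - e))"
  by (rule ext) (subst series_mult_superset[of "{e}"], auto)

lemma series_mult_add_left: "(P + Q) \<star> H = (\<lambda>d. (P \<star> H) d + (Q \<star> H) d)"
proof
  fix d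
  let ?K = "Poly_Mapping.keys P \<union> Poly_Mapping.keys Q"
  have "(R \<star> H) d = (\<Sum>e\<in>?K. Poly_Mapping.lookup R e * H (d - e))" if "Poly_Mapping.keys R \<subseteq> ?K" for R
    using that by (intro series_mult_superset) auto
  note this[of P] this[of Q] this[of "P + Q"]
  then show "((P + Q) \<star> H) d = (P \<star> H) d + (Q \<star> H) d"
    using keys_add[of P Q] by (simp add: lookup_add distrib_right sum.distrib)
qed

lemma laurent_induct [case_names zero single add]:
  fixes P :: "('r::finite, 'n::finite) laurent"
  assumes "\<Phi> 0" "\<And>e c. \<Phi> (Poly_Mapping.single e c)" "\<And>P Q. \<Phi> P \<Longrightarrow> \<Phi> Q \<Longrightarrow> \<Phi> (P + Q)"
  shows "\<Phi> P"
proof -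
  have "P = (\<Sum>e\<in>Poly_Mapping.keys P. Poly_Mapping.single e (Poly_Mapping.lookup P e))"
    by (rule poly_mapping_eqI) (auto simp: lookup_sum lookup_single when_def in_keys_iff)
  moreover have "\<Phi> (\<Sum>e\<in>K. Poly_Mapping.single e (Poly_Mapping.lookup P e))" if "finite K" for K
    using that by (induction K) (auto intro: assms)
  ultimately show ?thesis by (metis finite_keys)
qed

lemma series_mult_add_right: "P \<star> (\<lambda>d. H d + G d) = (\<lambda>d. (P \<star> H) d + (P \<star> G) d)"
  by (simp add: laurent_times_series_def fun_eq_iff distrib_left sum.distrib)

lemma series_mult_diff_right: "P \<star> (\<lambda>d. H d - G d) = (\<lambda>d. (P \<star> H) d - (P \<star> G) d)"
  by (simp add: laurent_times_series_def fun_eq_iff right_diff_distrib sum_subtractf)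

lemma series_mult_sum_right: "P \<star> (\<lambda>d. \<Sum>j\<in>J. H j d) = (\<lambda>d. \<Sum>j\<in>J. (P \<star> H j) d)"
proof (induction J rule: infinite_finite_induct)
  case (insert x F)
  then show ?case by (simp add: series_mult_add_right)
qed (simp_all add: laurent_times_series_def)

lemma series_mult_diff_left: "(P - Q) \<star> H = (\<lambda>d. (P \<star> H) d - (Q \<star> H) d)"
  using series_mult_add_left[of "P - Q" Q H] by (simp add: fun_eq_iff)

lemma series_mult_mult: "(P * Q) \<star> H = P \<star> (Q \<star> H)"
proof (induction P arbitrary: H rule: laurent_induct)
  case (single e c)
  show ?case
  proof (induction Q arbitrary: H rule: laurent_induct)
    case (single e' c')
    then show ?case by (simp add: mult_single series_mult_single algebra_simps)
  next
    case (add P Q)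
    then show ?case by (simp add: distrib_left series_mult_add_left series_mult_add_right)
  qed (simp add: series_mult_single)
next
  case (add P Q)
  then show ?case by (simp add: distrib_right series_mult_add_left)
qed simp

lemma series_mult_one [simp]: "1 \<star> H = H"
  using series_mult_single[of 0 1 H] by simp

lemma series_mult_numeral: "numeral n \<star> H = (\<lambda>d. numeral n * H d)"
  using series_mult_single[of 0 "numeral n" H] by simp

lemma series_mult_lookup: "P \<star> Poly_Mapping.lookup Q = Poly_Mapping.lookup (P * Q)"
proof (induction P rule: laurent_induct)
  case (single e c)
  show ?case
  proof (induction Q rule: laurent_induct)
    case (single e' c')
    show ?case by (auto simp: series_mult_single mult_single lookup_single when_def fun_eq_iff algebra_simps)
  next
    case (add P Q)
    then show ?case
      by (simp add: distrib_left lookup_add[abs_def] series_mult_add_right)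
  qed (simp add: series_mult_single fun_eq_iff)
next
  case (add P Q)
  then show ?case by (simp add: distrib_right lookup_add[abs_def] series_mult_add_left)
qed (simp add: fun_eq_iff)

lemma series_mult_u: "u_var i \<star> H = (\<lambda>d. H (d - (axis i 1, 0)))"
  by (simp add: u_var_def series_mult_single)

lemma series_mult_ut: "(u_var i * t_var j) \<star> H = (\<lambda>d. H (d - (axis i 1, axis j 1)))"
  by (simp add: u_var_def t_var_def mult_single series_mult_single)

lemma series_mult_commute: "P \<star> (Q \<star> H) = Q \<star> (P \<star> H)"
  by (simp only: series_mult_mult[symmetric] mult.commute)

text \<open>
  Series without terms of very negative degree in \<open>u_var 2\<close>. On all series,
  \<open>u_var 1 - u_var 2\<close> is a zero divisor: it annihilates the sum of all \<open>u_var 1 ^ i * u_var 2 ^ (- i)\<close>.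
\<close>

definition bounded_second :: "((2, 'n::finite) mdeg \<Rightarrow> int) \<Rightarrow> bool" where
  "bounded_second F \<longleftrightarrow> (\<exists>N. \<forall>d. fst d $ 2 < N \<longrightarrow> F d = 0)"

lemma bounded_second_series_mult:
  assumes "bounded_second F" shows "bounded_second (P \<star> F)"
proof -
  obtain N where N: "\<And>d. fst d $ 2 < N \<Longrightarrow> F d = 0" using assms unfolding bounded_second_def by blast
  define M where "M = Min (insert 0 ((\<lambda>e. fst e $ 2) ` Poly_Mapping.keys P))"
  have "(P \<star> F) d = 0" if "fst d $ 2 < N + M" for d
  proof -
    have "F (d - e) = 0" if "e \<in> Poly_Mapping.keys P" for e
    proof -
      have "M \<le> fst e $ 2" unfolding M_def using that by (intro Min_le) auto
      then show ?thesis using \<open>fst d $ 2 < N + M\<close> by (intro N) simp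
    qed
    then show ?thesis by (simp add: laurent_times_series_def)
  qed
  then show ?thesis unfolding bounded_second_def by blast
qed

lemma bounded_second_lookup:
  fixes P :: "(2, 'n::finite) laurent"
  shows "bounded_second (Poly_Mapping.lookup P)"
proof -
  have "Poly_Mapping.lookup (1 :: (2, 'n) laurent) d = 0" if "fst d $ 2 < 0" for d :: "(2, 'n) mdeg"
    using that by (auto simp: lookup_one when_def)
  then have "bounded_second (Poly_Mapping.lookup (1 :: (2, 'n) laurent))"
    unfolding bounded_second_def by blast
  then have "bounded_second (P \<star> Poly_Mapping.lookup 1)" by (rule bounded_second_series_mult)
  then show ?thesis by (simp add: series_mult_lookup)
qed

lemma bounded_second_diff: "bounded_second F \<Longrightarrow> bounded_second G \<Longrightarrow> bounded_second (\<lambda>d. F d - G d)"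
  unfolding bounded_second_def
proof (elim exE)
  fix M N assume "\<forall>d. fst d $ 2 < M \<longrightarrow> F d = 0" "\<forall>d. fst d $ 2 < N \<longrightarrow> G d = 0"
  then show "\<exists>N. \<forall>d. fst d $ 2 < N \<longrightarrow> F d - G d = 0" by (intro exI[of _ "min M N"]) auto
qed

abbreviation u_diff :: "(2, 'n::finite) laurent" where
  "u_diff \<equiv> u_var 1 - u_var 2"

text \<open>
  The hypothesis makes \<open>F\<close> constant along the direction \<open>(1, -1)\<close> of row degrees, and the values
  far out in this direction are zero.
\<close>

lemma u_diff_cancel:
  fixes F :: "(2, 'n::finite) mdeg \<Rightarrow> int"
  assumes "bounded_second F" and 0: "u_diff \<star> F = (\<lambda>d. 0)"
  shows "F = (\<lambda>d. 0)"
proof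
  fix d
  obtain N where N: "\<And>d. fst d $ 2 < N \<Longrightarrow> F d = 0" using assms(1) unfolding bounded_second_def by blast
  have step: "F d = F (d + (axis 1 1 - axis 2 1, 0))" for d
  proof -
    have "F (d + (axis 1 1, 0) - (axis 1 1, 0)) = F (d + (axis 1 1, 0) - (axis 2 1, 0))"
      using fun_cong[OF 0, of "d + (axis 1 1, 0)"] by (simp add: series_mult_diff_left series_mult_u)
    moreover have "d + (axis 1 1, 0) - (axis 2 1, 0) = d + (axis 1 1 - axis 2 1, 0)"
      by (simp add: prod_eq_iff)
    ultimately show ?thesis by simp
  qed
  have "F d = 0" if "fst d $ 2 < N + int n" for n
    using that
  proof (induction n arbitrary: d)
    case (Suc n)
    have "F (d + (axis 1 1 - axis 2 1, 0)) = 0"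
      using Suc.prems by (intro Suc.IH) (simp add: axis_def)
    then show ?case using step[of d] by simp
  qed (simp add: N)
  from this[of "nat (fst d $ 2 - N + 1)"] show "F d = 0" by simp
qed

section \<open>Euler products and their inverses\<close>

text \<open>
  Nonnegative column degrees, and the row degrees exceed them by \<open>c\<close> in total. The monomials in
  the \<open>u_var i * t_var j\<close> have \<open>c = 0\<close>, and multiplication by \<open>u_var i\<close> raises \<open>c\<close> by one.
\<close>

definition homogeneous_excess :: "int \<Rightarrow> (2, 'n::finite) mdeg \<Rightarrow> bool" where
  "homogeneous_excess c d \<longleftrightarrow> (\<forall>j. 0 \<le> snd d $ j) \<and> fst d $ 1 + fst d $ 2 = (\<Sum>j\<in>UNIV. snd d $ j) + c"

lemma axis_simps [simp]:
  "axis (1::2) (c::int) $ 1 = c" "axis (1::2) (c::int) $ 2 = 0"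
  "axis (2::2) (c::int) $ 1 = 0" "axis (2::2) (c::int) $ 2 = c"
  by (simp_all add: axis_def)

lemma homogeneous_excess_u: "homogeneous_excess c (d - (axis i 1, 0)) = homogeneous_excess (c + 1) d"
  using exhaust_2[of i] by (auto simp: homogeneous_excess_def)

lemma sum_axis: "(\<Sum>l\<in>UNIV. axis j (1::int) $ l) = 1" for j :: "'n::finite"
  by (simp add: axis_def)

lemma homogeneous_excess_ut:
  "homogeneous_excess c (d - (axis i 1, axis j 1)) \<longleftrightarrow> homogeneous_excess c d \<and> 1 \<le> snd d $ j"
proof -
  have 1: "(\<forall>l. 0 \<le> snd d $ l - axis j 1 $ l) \<longleftrightarrow> (\<forall>l. 0 \<le> snd d $ l) \<and> 1 \<le> snd d $ j"
  proof (intro iffI conjI allI)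
    assume L: "\<forall>l. 0 \<le> snd d $ l - axis j 1 $ l"
    show "0 \<le> snd d $ l" for l using L[rule_format, of l] by (cases "l = j") (simp_all add: axis_def)
    show "1 \<le> snd d $ j" using L[rule_format, of j] by (simp add: axis_def)
  next
    fix l assume "(\<forall>l. 0 \<le> snd d $ l) \<and> 1 \<le> snd d $ j"
    then show "0 \<le> snd d $ l - axis j 1 $ l" by (cases "l = j") (simp_all add: axis_def)
  qed
  have 2: "snd (d - (axis i 1, axis j 1)) $ l = snd d $ l - axis j 1 $ l" for l by simp
  have 3: "fst (d - (axis i 1, axis j 1)) $ 1 + fst (d - (axis i 1, axis j 1)) $ 2 = fst d $ 1 + fst d $ 2 - 1"
    using exhaust_2[of i] by auto
  show ?thesis
    unfolding homogeneous_excess_def 2 3 1 sum_subtractf sum_axis by auto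
qed

text \<open>
  The product over \<open>j \<in> J\<close> of the geometric series \<open>1 / (1 - u_var i' * t_var j)\<close>, where \<open>i'\<close> is
  the row other than \<open>i\<close>: its terms have degree zero in row \<open>i\<close>.
\<close>

definition geometric_product :: "2 \<Rightarrow> 'n::finite set \<Rightarrow> (2, 'n) mdeg \<Rightarrow> int" where
  "geometric_product i J d = of_bool (homogeneous_excess 0 d \<and> fst d $ i = 0 \<and> (\<forall>j. j \<notin> J \<longrightarrow> snd d $ j = 0))"

lemma geometric_product_step:
  fixes j :: "'n::finite"
  assumes "i \<noteq> i'" "j \<notin> J"
  shows "(1 - u_var i' * t_var j) \<star> geometric_product i (insert j J) = geometric_product i J"
proof
  fix d :: "(2, 'n::finite) mdeg"
  have i: "fst (d - (axis i' 1, axis j 1)) $ i = fst d $ i" using assms(1) by (simp add: axis_def)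
  have l: "snd (d - (axis i' 1, axis j 1)) $ l = snd d $ l" if "l \<noteq> j" for l using that by (simp add: axis_def)
  have *: "geometric_product i (insert j J) (d - (axis i' 1, axis j 1)) =
      of_bool (homogeneous_excess 0 d \<and> 1 \<le> snd d $ j \<and> fst d $ i = 0 \<and> (\<forall>l. l \<notin> insert j J \<longrightarrow> snd d $ l = 0))"
    unfolding geometric_product_def homogeneous_excess_ut i using l by (intro arg_cong[of _ _ of_bool]) auto
  show "((1 - u_var i' * t_var j) \<star> geometric_product i (insert j J)) d = geometric_product i J d"
  proof (cases "homogeneous_excess 0 d")
    case True
    then have nn: "0 \<le> snd d $ j" by (simp add: homogeneous_excess_def)
    show ?thesis
    proof (cases "snd d $ j = 0")
      case True
      then have "(\<forall>l. l \<notin> insert j J \<longrightarrow> snd d $ l = 0) \<longleftrightarrow> (\<forall>l. l \<notin> J \<longrightarrow> snd d $ l = 0)" by auto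
      then show ?thesis using True
        unfolding series_mult_diff_left series_mult_one series_mult_ut * by (simp add: geometric_product_def)
    next
      case False
      then have "1 \<le> snd d $ j" using nn by simp
      moreover have "\<not> (\<forall>l. l \<notin> J \<longrightarrow> snd d $ l = 0)" using False assms(2) by auto
      ultimately show ?thesis
        unfolding series_mult_diff_left series_mult_one series_mult_ut * by (simp add: geometric_product_def)
    qed
  next
    case False
    then show ?thesis
      unfolding series_mult_diff_left series_mult_one series_mult_ut * by (simp add: geometric_product_def)
  qed
qed

lemma euler_product_times_full_geometric_product:
  fixes i i' :: 2
  assumes "i \<noteq> i'"
  shows "(\<Prod>j\<in>UNIV. 1 - u_var i' * t_var j) \<star> geometric_product i (UNIV :: 'n::finite set) = Poly_Mapping.lookup 1"
proof -
  have "(\<Prod>j\<in>J. 1 - u_var i' * t_var j) \<star> geometric_product i J = geometric_product i {}" for J :: "'n set"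
  proof (induction J rule: infinite_finite_induct)
    case (insert j J)
    then show ?case by (simp add: series_mult_mult mult.commute[of "1 - _"] geometric_product_step[OF assms] del: insert_iff)
  qed simp_all
  moreover have "geometric_product i {} = Poly_Mapping.lookup (1 :: (2, 'n) laurent)"
  proof
    fix d :: "(2, 'n) mdeg"
    have "(homogeneous_excess 0 d \<and> fst d $ i = 0 \<and> (\<forall>j. snd d $ j = 0)) \<longleftrightarrow> d = 0"
      using assms exhaust_2[of i] exhaust_2[of i']
      by (auto simp: homogeneous_excess_def prod_eq_iff vec_eq_iff forall_2)
    then show "geometric_product i {} d = Poly_Mapping.lookup 1 d"
      by (simp add: geometric_product_def lookup_one when_def)
  qed
  ultimately show ?thesis by simp
qed

text \<open>
  The geometric product over all columns for the row other than \<open>i\<close>, times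
  \<open>u_var i * t_var j / (1 - u_var i * t_var j)\<close>: up to \<open>snd d $ j\<close> of the factors
  \<open>t_var j\<close>, but at least one, are paired with \<open>u_var i\<close>.
\<close>

definition weighted_geometric_product :: "2 \<Rightarrow> 'n::finite \<Rightarrow> (2, 'n) mdeg \<Rightarrow> int" where
  "weighted_geometric_product i j d = of_bool (homogeneous_excess 0 d \<and> 1 \<le> fst d $ i \<and> fst d $ i \<le> snd d $ j)"

lemma weighted_geometric_product_step:
  "(1 - u_var i * t_var j) \<star> weighted_geometric_product i j = (u_var i * t_var j) \<star> geometric_product i UNIV"
proof
  fix d :: "(2, 'a) mdeg"
  have i: "fst (d - (axis i 1, axis j 1)) $ i = fst d $ i - 1" by (simp add: axis_def)
  have j: "snd (d - (axis i 1, axis j 1)) $ j = snd d $ j - 1" by (simp add: axis_def)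
  show "((1 - u_var i * t_var j) \<star> weighted_geometric_product i j) d = ((u_var i * t_var j) \<star> geometric_product i UNIV) d"
    unfolding series_mult_diff_left series_mult_one series_mult_ut weighted_geometric_product_def geometric_product_def
      homogeneous_excess_ut i j by auto
qed

section \<open>A closed form of the Hilbert series\<close>

text \<open>
  The untruncated dimension of layer \<open>k\<close>, as a function of an integer \<open>k\<close> that is extended by zero
  to negative arguments.
\<close>

definition dim_profile :: "('n::finite \<Rightarrow> nat) \<Rightarrow> int \<Rightarrow> int" where
  "dim_profile b k = (if k < 0 then 0 else 1 - 2 * k) + (\<Sum>j\<in>UNIV. max 0 (min (int (b j)) k))"

lemma dim_profile_of_nat: "max 0 (dim_profile b (int k)) = int (layer_dim b k)"
proof -
  have "(\<Sum>j\<in>UNIV. max 0 (min (int (b j)) (int k))) = (\<Sum>j\<in>UNIV. int (min (b j) k))"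
    by (intro sum.cong) auto
  then show ?thesis by (simp add: dim_profile_def layer_dim_def)
qed

text \<open>
  The profile is piecewise linear: it jumps at \<open>0\<close>, and each column contributes a ramp that stops
  at \<open>b j\<close>.
\<close>

lemma dim_profile_second_difference:
  "dim_profile b k - 2 * dim_profile b (k - 1) + dim_profile b (k - 2) =
    of_bool (k = 0) - 3 * of_bool (k = 1) +
    (\<Sum>j\<in>UNIV. of_bool (1 \<le> k \<and> k \<le> int (b j)) - of_bool (1 \<le> k - 1 \<and> k - 1 \<le> int (b j)))"
proof -
  have "(\<Sum>j\<in>UNIV. max 0 (min (int (b j)) k)) - 2 * (\<Sum>j\<in>UNIV. max 0 (min (int (b j)) (k - 1))) +
     (\<Sum>j\<in>UNIV. max 0 (min (int (b j)) (k - 2))) =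
     (\<Sum>j\<in>UNIV. max 0 (min (int (b j)) k) - 2 * max 0 (min (int (b j)) (k - 1)) + max 0 (min (int (b j)) (k - 2)))"
    by (simp add: sum.distrib sum_subtractf sum_distrib_left)
  also have "\<dots> = (\<Sum>j\<in>UNIV. of_bool (1 \<le> k \<and> k \<le> int (b j)) - of_bool (1 \<le> k - 1 \<and> k - 1 \<le> int (b j)))"
    by (intro sum.cong) (auto simp: max_def min_def)
  finally have sums: "(\<Sum>j\<in>UNIV. max 0 (min (int (b j)) k)) - 2 * (\<Sum>j\<in>UNIV. max 0 (min (int (b j)) (k - 1))) +
     (\<Sum>j\<in>UNIV. max 0 (min (int (b j)) (k - 2))) =
     (\<Sum>j\<in>UNIV. of_bool (1 \<le> k \<and> k \<le> int (b j)) - of_bool (1 \<le> k - 1 \<and> k - 1 \<le> int (b j)))" .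
  have heads: "(if k < 0 then 0 else 1 - 2 * k) - 2 * (if k - 1 < 0 then 0 else 1 - 2 * (k - 1)) +
      (if k - 2 < 0 then 0 else 1 - 2 * (k - 2)) = of_bool (k = 0) - 3 * of_bool (k = 1)"
    by auto
  have add: "g - 2 * g' + g'' = y \<Longrightarrow> a - 2 * a' + a'' = x \<Longrightarrow> g + a - 2 * (g' + a') + (g'' + a'') = y + x"
    for a a' a'' g g' g'' x y :: int by simp
  show ?thesis unfolding dim_profile_def by (rule add[OF heads sums])
qed

text \<open>
  The truncation in the dimension of layer \<open>k\<close> is compensated by the profile at the reflected
  index \<open>l\<close>. If no column exceeds \<open>l\<close>, then the profile at \<open>l\<close> is just \<open>k - l\<close> and the one at \<open>k\<close> is
  nonnegative. If a column exceeds \<open>l\<close>, then it is more than half of the total degree, all other columns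
  are smaller than \<open>k\<close>, and both profiles are the same linear function of their argument.
\<close>

lemma dim_profile_reflection:
  assumes k: "0 \<le> k" "k < l" and kl: "k + l = int (sum b UNIV) + 1"
  shows "max 0 (dim_profile b k) = dim_profile b k - dim_profile b l + (k - l)"
proof (cases "\<exists>i. int (b i) > l")
  case True
  then obtain i where i: "l < int (b i)" ..
  define m where "m = int (sum b UNIV)"
  have msum: "int (b i) + (\<Sum>j\<in>UNIV - {i}. int (b j)) = m"
    using sum.remove[of UNIV i "\<lambda>j. int (b j)"] by (simp add: m_def)
  have small: "int (b j) < k" if "j \<noteq> i" for j
  proof -
    have "int (b j) \<le> (\<Sum>j\<in>UNIV - {i}. int (b j))" using that by (intro member_le_sum) auto
    then show ?thesis using msum i kl by (simp add: m_def)
  qed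
  have profile: "dim_profile b t = 1 - t + m - int (b i)" if "k \<le> t" "t \<le> l" for t
  proof -
    have "(\<Sum>j\<in>UNIV - {i}. max 0 (min (int (b j)) t)) = (\<Sum>j\<in>UNIV - {i}. int (b j))"
      using small that by (intro sum.cong) (force simp: min_def)+
    moreover have "(\<Sum>j\<in>UNIV. max 0 (min (int (b j)) t)) = t + (\<Sum>j\<in>UNIV - {i}. max 0 (min (int (b j)) t))"
      using i that k by (subst sum.remove[of UNIV i]) auto
    ultimately show ?thesis using that k msum by (simp add: dim_profile_def)
  qed
  have "dim_profile b k < 0" using profile[of k] k kl i by (simp add: m_def)
  then show ?thesis using profile[of k] profile[of l] k by simp
next
  case False
  then have le: "int (b j) \<le> l" for j by (simp add: not_less)
  have "(\<Sum>j\<in>UNIV. max 0 (min (int (b j)) l)) = int (sum b UNIV)"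
    using le by (simp add: min_def)
  then have l: "dim_profile b l = k - l" using k kl by (simp add: dim_profile_def)
  have "2 * k - 1 \<le> (\<Sum>j\<in>UNIV. max 0 (min (int (b j)) k))"
  proof (cases "\<exists>i. k \<le> int (b i)")
    case True
    then obtain i where i: "k \<le> int (b i)" ..
    have split: "(\<Sum>j\<in>UNIV. max 0 (min (int (b j)) k)) = k + (\<Sum>j\<in>UNIV - {i}. max 0 (min (int (b j)) k))"
      using i k by (subst sum.remove[of UNIV i]) auto
    have "k - 1 \<le> (\<Sum>j\<in>UNIV - {i}. max 0 (min (int (b j)) k))"
    proof (cases "\<exists>i'. i' \<noteq> i \<and> k \<le> int (b i')")
      case True
      then obtain i' where i': "i' \<noteq> i" "k \<le> int (b i')" by blast
      have "max 0 (min (int (b i')) k) \<le> (\<Sum>j\<in>UNIV - {i}. max 0 (min (int (b j)) k))"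
        using i' by (intro member_le_sum) auto
      then show ?thesis using i' k by simp
    next
      case False
      then have "(\<Sum>j\<in>UNIV - {i}. max 0 (min (int (b j)) k)) = (\<Sum>j\<in>UNIV - {i}. int (b j))"
        by (intro sum.cong) (force simp: min_def)+
      also have "\<dots> = int (sum b UNIV) - int (b i)"
        using sum.remove[of UNIV i "\<lambda>j. int (b j)"] by simp
      finally show ?thesis using le[of i] kl by simp
    qed
    then show ?thesis using split by simp
  next
    case False
    then have lt: "int (b j) < k" for j by (simp add: not_le)
    have "(\<Sum>j\<in>UNIV. max 0 (min (int (b j)) k)) = (\<Sum>j\<in>UNIV. int (b j))"
      by (simp add: min_absorb1 less_imp_le[OF lt])
    then show ?thesis using k kl by simp
  qed
  then have "0 \<le> dim_profile b k" using k by (simp add: dim_profile_def)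
  then show ?thesis using l by simp
qed

definition orbit_series :: "(2, 'n::finite) mdeg \<Rightarrow> int" where
  "orbit_series d = int (orbit_hilbert d)"

definition column_degrees :: "(2, 'n::finite) mdeg \<Rightarrow> 'n \<Rightarrow> nat" where
  "column_degrees d j = nat (snd d $ j)"

lemma orbit_series_eq:
  "orbit_series d = (if homogeneous_excess 0 d \<and> 0 \<le> fst d $ 1 \<and> 0 \<le> fst d $ 2
    then \<Sum>k<Suc (nat (min (fst d $ 1) (fst d $ 2))). int (layer_dim (column_degrees d) k) else 0)"
proof -
  have b: "(\<lambda>j. nat (snd d $ j)) = column_degrees d" by (simp add: column_degrees_def fun_eq_iff)
  show ?thesis
    unfolding orbit_series_def orbit_hilbert_def homogeneous_excess_def b by (auto simp: min_def)
qed

text \<open>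
  The Hilbert functions in the row degrees \<open>(x - 1, y)\<close> and \<open>(x, y - 1)\<close> are sums of layer
  dimensions that differ in a single term, the one for the smaller of \<open>x\<close> and \<open>y\<close>. The reflection
  formula makes the result antisymmetric and free of truncations, also where \<open>x\<close> or \<open>y\<close> is
  negative.
\<close>

lemma orbit_series_difference:
  "(u_diff \<star> orbit_series) d = of_bool (homogeneous_excess 1 d) *
    (dim_profile (column_degrees d) (fst d $ 2) - dim_profile (column_degrees d) (fst d $ 1) + (fst d $ 2 - fst d $ 1))"
proof -
  define b where "b = column_degrees d"
  define x y where "x = fst d $ 1" and "y = fst d $ 2"
  have c: "column_degrees (d - (axis i 1, 0)) = b" for i by (simp add: b_def column_degrees_def fun_eq_iff)
  have lhs: "(u_diff \<star> orbit_series) d =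
     (if homogeneous_excess 1 d \<and> 1 \<le> x \<and> 0 \<le> y then \<Sum>k<Suc (nat (min (x - 1) y)). int (layer_dim b k) else 0)
     - (if homogeneous_excess 1 d \<and> 0 \<le> x \<and> 1 \<le> y then \<Sum>k<Suc (nat (min x (y - 1))). int (layer_dim b k) else 0)"
    by (simp add: series_mult_diff_left series_mult_u orbit_series_eq homogeneous_excess_u c x_def y_def
        del: sum.lessThan_Suc)
  show ?thesis
  proof (cases "homogeneous_excess 1 d")
    case False
    then show ?thesis unfolding lhs by simp
  next
    case True
    have nn: "0 \<le> snd d $ j" for j using True by (simp add: homogeneous_excess_def)
    have "int (sum b UNIV) = (\<Sum>j\<in>UNIV. snd d $ j)" using nn by (simp add: b_def column_degrees_def)
    then have xy: "x + y = int (sum b UNIV) + 1" using True by (simp add: homogeneous_excess_def x_def y_def)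
    have big: "dim_profile b t = 1 - 2 * t + int (sum b UNIV)" if "int (sum b UNIV) \<le> t" for t
    proof -
      have "int (b j) \<le> t" for j
      proof -
        have "b j \<le> sum b UNIV" by (rule member_le_sum) auto
        then have "int (b j) \<le> int (sum b UNIV)" by (simp only: of_nat_le_iff)
        then show ?thesis using that by (rule order.trans)
      qed
      then have "(\<Sum>j\<in>UNIV. max 0 (min (int (b j)) t)) = int (sum b UNIV)" by (simp add: min_def)
      moreover have "0 \<le> t" using of_nat_0_le_iff that by (rule order.trans)
      ultimately show ?thesis by (simp add: dim_profile_def)
    qed
    have neg: "dim_profile b t = 0" if "t < 0" for t
      using that by (simp add: dim_profile_def max_def min_def)
    have partial: "(\<Sum>k<Suc (nat t). int (layer_dim b k)) = (\<Sum>k<nat t. int (layer_dim b k)) + max 0 (dim_profile b t)"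
      if "0 \<le> t" for t using dim_profile_of_nat[of b "nat t"] that by simp
    have "(if 1 \<le> x \<and> 0 \<le> y then \<Sum>k<Suc (nat (min (x - 1) y)). int (layer_dim b k) else 0)
     - (if 0 \<le> x \<and> 1 \<le> y then \<Sum>k<Suc (nat (min x (y - 1))). int (layer_dim b k) else 0)
     = dim_profile b y - dim_profile b x + (y - x)" (is "?A - ?B = ?C")
    proof -
      consider "y < 0" | "x < 0" | "0 \<le> y" "y < x" | "0 \<le> x" "x < y" | "x = y" "0 \<le> x" by linarith
      then show ?thesis
      proof cases
        case 1
        then show ?thesis using neg[of y] big[of x] xy by simp
      next
        case 2
        then show ?thesis using neg[of x] big[of y] xy by simp
      next
        case 3
        have "Suc (nat (y - 1)) = nat y" if "1 \<le> y" using that by simp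
        moreover have "min (x - 1) y = y" "min x (y - 1) = y - 1" using 3 by auto
        ultimately have "?A - ?B = max 0 (dim_profile b y)"
          using 3 partial[of y] by (cases "y = 0") (simp_all del: sum.lessThan_Suc)
        then show ?thesis using dim_profile_reflection[of y x b] 3 xy by simp
      next
        case 4
        have "Suc (nat (x - 1)) = nat x" if "1 \<le> x" using that by simp
        moreover have "min (x - 1) y = x - 1" "min x (y - 1) = x" using 4 by auto
        ultimately have "?B - ?A = max 0 (dim_profile b x)"
          using 4 partial[of x] by (cases "x = 0") (simp_all del: sum.lessThan_Suc)
        then show ?thesis using dim_profile_reflection[of x y b] 4 xy by simp
      next
        case 5
        then show ?thesis by (auto simp: min_def simp del: sum.lessThan_Suc)
      qed
    qed
    then show ?thesis unfolding lhs using True by (simp add: b_def x_def y_def del: sum.lessThan_Suc)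
  qed
qed

abbreviation (input) U :: "(2, 'n::finite) laurent" where "U \<equiv> u_var 1"
abbreviation (input) V :: "(2, 'n::finite) laurent" where "V \<equiv> u_var 2"

text \<open>
  The remaining two factors form second differences. They remove the linear correction, and turn
  the profiles into the indicator functions that make up the geometric products.
\<close>

lemma orbit_series_closed_form:
  "u_diff \<star> (u_diff \<star> (u_diff \<star> orbit_series)) = (\<lambda>d.
     ((U * U * (U - 3 * V)) \<star> geometric_product 2 UNIV) d
     + ((U * U * (U - V)) \<star> (\<lambda>d. \<Sum>j\<in>UNIV. weighted_geometric_product 2 j d)) d
     - ((V * V * (V - 3 * U)) \<star> geometric_product 1 UNIV) d
     - ((V * V * (V - U)) \<star> (\<lambda>d. \<Sum>j\<in>UNIV. weighted_geometric_product 1 j d)) d)"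
proof
  fix d :: "(2, 'a::finite) mdeg"
  define b where "b = column_degrees d"
  define x y where "x = fst d $ 1" and "y = fst d $ 2"
  have c: "column_degrees (e - (axis i 1, 0)) = column_degrees e" for e :: "(2, 'a) mdeg" and i
    by (simp add: column_degrees_def fun_eq_iff)
  define h where "h = (of_bool (homogeneous_excess 3 d) :: int)"
  have lhs: "(u_diff \<star> (u_diff \<star> (u_diff \<star> orbit_series))) d = h *
      ((dim_profile b y - 2 * dim_profile b (y - 1) + dim_profile b (y - 2))
      - (dim_profile b x - 2 * dim_profile b (x - 1) + dim_profile b (x - 2)))"
  proof -
    have "(u_diff \<star> (u_diff \<star> G)) d = G (d - (axis 1 1, 0) - (axis 1 1, 0)) -
        2 * G (d - (axis 1 1, 0) - (axis 2 1, 0)) + G (d - (axis 2 1, 0) - (axis 2 1, 0))" for G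
    proof -
      have comm: "d - (axis 2 1, 0) - (axis 1 1, 0) = d - (axis 1 1, 0) - (axis 2 1, 0)"
        by (simp add: algebra_simps)
      show ?thesis by (simp add: series_mult_diff_left series_mult_u comm)
    qed
    then show ?thesis
      by (simp add: orbit_series_difference homogeneous_excess_u c h_def b_def x_def y_def)
  qed
  define hd where "hd = homogeneous_excess 3 d"
  have bj: "int (b j) = snd d $ j" if hd for j
    using that by (simp add: b_def column_degrees_def hd_def homogeneous_excess_def)
  have S2: "((U * U * (U - 3 * V)) \<star> geometric_product 2 UNIV) d = h * (of_bool (y = 0) - 3 * of_bool (y = 1))"
    unfolding series_mult_mult series_mult_diff_left series_mult_u series_mult_numeral geometric_product_def h_def
    by (simp add: homogeneous_excess_u y_def)
  have S1: "((V * V * (V - 3 * U)) \<star> geometric_product 1 UNIV) d = h * (of_bool (x = 0) - 3 * of_bool (x = 1))"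
    unfolding series_mult_mult series_mult_diff_left series_mult_u series_mult_numeral geometric_product_def h_def
    by (simp add: homogeneous_excess_u x_def)
  have R2: "((U * U * (U - V)) \<star> (\<lambda>d. \<Sum>j\<in>UNIV. weighted_geometric_product 2 j d)) d =
    h * (\<Sum>j\<in>UNIV. of_bool (1 \<le> y \<and> y \<le> int (b j)) - of_bool (1 \<le> y - 1 \<and> y - 1 \<le> int (b j)))"
    unfolding series_mult_mult series_mult_diff_left series_mult_u weighted_geometric_product_def h_def
    using bj by (cases hd) (simp_all add: homogeneous_excess_u y_def hd_def sum_subtractf)
  have R1: "((V * V * (V - U)) \<star> (\<lambda>d. \<Sum>j\<in>UNIV. weighted_geometric_product 1 j d)) d =
    h * (\<Sum>j\<in>UNIV. of_bool (1 \<le> x \<and> x \<le> int (b j)) - of_bool (1 \<le> x - 1 \<and> x - 1 \<le> int (b j)))"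
    unfolding series_mult_mult series_mult_diff_left series_mult_u weighted_geometric_product_def h_def
    using bj by (cases hd) (simp_all add: homogeneous_excess_u x_def hd_def sum_subtractf)
  show "(u_diff \<star> (u_diff \<star> (u_diff \<star> orbit_series))) d = 
     ((U * U * (U - 3 * V)) \<star> geometric_product 2 UNIV) d
     + ((U * U * (U - V)) \<star> (\<lambda>d. \<Sum>j\<in>UNIV. weighted_geometric_product 2 j d)) d
     - ((V * V * (V - 3 * U)) \<star> geometric_product 1 UNIV) d
     - ((V * V * (V - U)) \<star> (\<lambda>d. \<Sum>j\<in>UNIV. weighted_geometric_product 1 j d)) d"
    unfolding lhs S1 S2 R1 R2 dim_profile_second_difference by (simp only: algebra_simps)
qed

section \<open>Schur polynomials with two rows in two variables\<close>

lemma two_row_cells: "young_cells [l1, l2] = {0} \<times> {..<l1} \<union> {1} \<times> {..<l2}"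
proof (intro set_eqI)
  fix z :: "nat \<times> nat"
  obtain p q where z: "z = (p, q)" by (cases z)
  consider "p = 0" | "p = 1" | "2 \<le> p" by linarith
  then show "z \<in> young_cells [l1, l2] \<longleftrightarrow> z \<in> {0} \<times> {..<l1} \<union> {1} \<times> {..<l2}"
    by cases (simp_all add: z young_cells_def)
qed

text \<open>
  The semistandard tableau with entries \<open>0\<close> and \<open>1\<close> whose first row has \<open>i\<close> zeros.
\<close>

definition two_row_tableau :: "nat \<Rightarrow> nat \<Rightarrow> nat \<Rightarrow> nat \<times> nat \<Rightarrow> nat" where
  "two_row_tableau l1 l2 i = restrict (\<lambda>(p, q). if p = 0 \<and> q < i then 0 else 1) (young_cells [l1, l2])"

lemma two_row_tableau_cells:
  "q < l1 \<Longrightarrow> two_row_tableau l1 l2 i (0, q) = (if q < i then 0 else 1)"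
  "q < l2 \<Longrightarrow> two_row_tableau l1 l2 i (1, q) = 1"
  by (simp_all add: two_row_tableau_def two_row_cells)

text \<open>
  In the columns of length two the entries are forced to be \<open>0\<close> above \<open>1\<close>, so at least \<open>l2\<close>
  entries of the first row are zero, and the number of zeros determines the tableau.
\<close>

lemma ssyt_two_rows:
  assumes "l2 \<le> l1"
  shows "bij_betw (two_row_tableau l1 l2) {l2..l1} (ssyt [l1, l2] 2)"
proof (rule bij_betwI')
  fix i i' assume i: "i \<in> {l2..l1}" "i' \<in> {l2..l1}"
  show "(two_row_tableau l1 l2 i = two_row_tableau l1 l2 i') = (i = i')"
  proof
    assume eq: "two_row_tableau l1 l2 i = two_row_tableau l1 l2 i'"
    show "i = i'"
    proof (rule ccontr)
      assume "i \<noteq> i'"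
      then have "min i i' < l1" using i by auto
      then show False
        using fun_cong[OF eq, of "(0, min i i')"] \<open>i \<noteq> i'\<close>
        by (simp add: two_row_tableau_cells min_def split: if_splits)
    qed
  qed simp
next
  fix i assume i: "i \<in> {l2..l1}"
  have mem: "(0, q) \<in> young_cells [l1, l2] \<longleftrightarrow> q < l1" "(Suc 0, q) \<in> young_cells [l1, l2] \<longleftrightarrow> q < l2" 
    "(Suc (Suc p), q) \<notin> young_cells [l1, l2]" for p q
    by (auto simp: two_row_cells)
  show "two_row_tableau l1 l2 i \<in> ssyt [l1, l2] 2"
    unfolding ssyt_def
  proof (intro CollectI conjI allI impI)
    show "two_row_tableau l1 l2 i \<in> young_cells [l1, l2] \<rightarrow>\<^sub>E {..<2}"
      by (auto simp: two_row_tableau_def)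
    fix p q
    show "two_row_tableau l1 l2 i (p, q) \<le> two_row_tableau l1 l2 i (p, Suc q)"
      if "(p, Suc q) \<in> young_cells [l1, l2]"
      using that by (auto simp: two_row_cells two_row_tableau_def)
    show "two_row_tableau l1 l2 i (p, q) < two_row_tableau l1 l2 i (Suc p, q)"
      if "(Suc p, q) \<in> young_cells [l1, l2]"
      using that i assms by (auto simp: two_row_cells two_row_tableau_def)
  qed
next
  fix T assume T: "T \<in> ssyt [l1, l2] 2"
  have ext: "T \<in> young_cells [l1, l2] \<rightarrow>\<^sub>E {..<2}"
    and row: "\<And>p q. (p, Suc q) \<in> young_cells [l1, l2] \<Longrightarrow> T (p, q) \<le> T (p, Suc q)"
    and col: "\<And>p q. (Suc p, q) \<in> young_cells [l1, l2] \<Longrightarrow> T (p, q) < T (Suc p, q)"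
    using T unfolding ssyt_def by blast+
  have two: "T z < 2" if "z \<in> young_cells [l1, l2]" for z using ext that by (auto dest: PiE_mem)
  \<comment> \<open>The number of zeros in the first row.\<close>
  define i where "i = (LEAST q. q = l1 \<or> T (0, q) \<noteq> 0)"
  have i_le: "i \<le> l1" unfolding i_def by (rule Least_le) simp
  have below: "T (0, q) = 0" if "q < i" for q
    using not_less_Least[of q "\<lambda>q. q = l1 \<or> T (0, q) \<noteq> 0"] that unfolding i_def by blast
  have at: "i = l1 \<or> T (0, i) \<noteq> 0"
    unfolding i_def by (rule LeastI[of _ l1]) simp
  have above: "i \<le> q \<Longrightarrow> q < l1 \<Longrightarrow> T (0, q) = 1" for q
  proof (induction q rule: dec_induct)
    case base
    then have "T (0, i) \<noteq> 0" using at by simp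
    moreover have "T (0, i) < 2" using base by (intro two) (simp add: two_row_cells)
    ultimately show ?case by simp
  next
    case (step q)
    then have "T (0, q) = 1" by simp
    moreover have "T (0, q) \<le> T (0, Suc q)" using step.prems by (intro row) (simp add: two_row_cells)
    moreover have "T (0, Suc q) < 2" using step.prems by (intro two) (simp add: two_row_cells)
    ultimately show ?case by simp
  qed
  have second: "T (0, q) = 0 \<and> T (1, q) = 1" if "q < l2" for q
  proof -
    have "T (0, q) < T (Suc 0, q)" using that by (intro col) (simp add: two_row_cells)
    moreover have "T (Suc 0, q) < 2" using that by (intro two) (simp add: two_row_cells)
    ultimately show ?thesis by simp
  qed
  have "l2 \<le> i"
  proof (rule ccontr)
    assume "\<not> l2 \<le> i"
    then have "i < l2" by simp
    then show False using second[of i] at assms by simp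
  qed
  moreover have "T = two_row_tableau l1 l2 i"
  proof
    fix z
    show "T z = two_row_tableau l1 l2 i z"
    proof (cases "z \<in> young_cells [l1, l2]")
      case True
      then consider q where "z = (0, q)" "q < l1" | q where "z = (1, q)" "q < l2"
        by (auto simp: two_row_cells)
      then show ?thesis
      proof cases
        case 1
        then show ?thesis using below[of q] above[of q] by (cases "q < i") (simp_all add: two_row_tableau_cells)
      next
        case 2
        then show ?thesis using second[of q] two_row_tableau_cells(2)[of q l2 l1 i] by simp
      qed
    next
      case False
      then show ?thesis using PiE_arb[OF ext False] by (simp add: two_row_tableau_def)
    qed
  qed
  ultimately show "\<exists>i\<in>{l2..l1}. T = two_row_tableau l1 l2 i" using i_le by auto
qed

lemma schur_two_rows:
  fixes x y :: "'a::comm_ring_1"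
  assumes "l2 \<le> l1"
  shows "schur [l1, l2] [x, y] = (\<Sum>i\<in>{l2..l1}. x ^ i * y ^ (l1 + l2 - i))"
proof -
  have "schur [l1, l2] [x, y] = (\<Sum>T\<in>ssyt [l1, l2] 2. \<Prod>z\<in>young_cells [l1, l2]. [x, y] ! T z)"
    by (simp add: schur_def numeral_2_eq_2)
  also have "\<dots> = (\<Sum>i\<in>{l2..l1}. \<Prod>z\<in>young_cells [l1, l2]. [x, y] ! two_row_tableau l1 l2 i z)"
    by (rule sum.reindex_bij_betw[OF ssyt_two_rows[OF assms], symmetric])
  also have "\<dots> = (\<Sum>i\<in>{l2..l1}. x ^ i * y ^ (l1 + l2 - i))"
  proof (intro sum.cong refl)
    fix i assume i: "i \<in> {l2..l1}"
    have "(\<Prod>z\<in>young_cells [l1, l2]. [x, y] ! two_row_tableau l1 l2 i z) =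
       (\<Prod>z\<in>{0} \<times> {..<l1}. [x, y] ! two_row_tableau l1 l2 i z) * (\<Prod>z\<in>{1} \<times> {..<l2}. [x, y] ! two_row_tableau l1 l2 i z)"
      unfolding two_row_cells by (rule prod.union_disjoint) auto
    also have "(\<Prod>z\<in>{0} \<times> {..<l1}. [x, y] ! two_row_tableau l1 l2 i z) = (\<Prod>q<l1. if q < i then x else y)"
    proof -
      have "{0::nat} \<times> {..<l1} = Pair 0 ` {..<l1}" by auto
      then have "(\<Prod>z\<in>{0} \<times> {..<l1}. [x, y] ! two_row_tableau l1 l2 i z) = (\<Prod>q<l1. [x, y] ! two_row_tableau l1 l2 i (0, q))"
        by (simp add: prod.reindex inj_on_def)
      also have "\<dots> = (\<Prod>q<l1. if q < i then x else y)"
        by (intro prod.cong refl) (simp add: two_row_tableau_cells)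
      finally show ?thesis .
    qed
    also have "(\<Prod>q<l1. if q < i then x else y) = x ^ i * y ^ (l1 - i)"
    proof -
      have "{..<l1} \<inter> {q. q < i} = {..<i}" "{..<l1} \<inter> - {q. q < i} = {i..<l1}" using i by auto
      then show ?thesis by (simp add: prod.If_cases)
    qed
    also have "(\<Prod>z\<in>{1} \<times> {..<l2}. [x, y] ! two_row_tableau l1 l2 i z) = y ^ l2"
    proof -
      have "{1::nat} \<times> {..<l2} = Pair 1 ` {..<l2}" by auto
      then show ?thesis using two_row_tableau_cells(2)[of _ l2 l1 i] by (simp add: prod.reindex inj_on_def)
    qed
    also have "x ^ i * y ^ (l1 - i) * y ^ l2 = x ^ i * y ^ (l1 + l2 - i)"
      using i by (simp add: mult.assoc flip: power_add)
    finally show "(\<Prod>z\<in>young_cells [l1, l2]. [x, y] ! two_row_tableau l1 l2 i z) = x ^ i * y ^ (l1 + l2 - i)" .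
  qed
  finally show ?thesis .
qed

lemma schur_two_rows_at_ones: "l2 \<le> l1 \<Longrightarrow> schur [l1, l2] [1, 1 :: 'a::comm_ring_1] = of_nat (l1 - l2 + 1)"
  by (simp add: schur_two_rows Suc_diff_le)

text \<open>
  The bialternant formula for two variables.
\<close>

lemma schur_two_rows_antisymmetric:
  fixes x y :: "'a::comm_ring_1"
  assumes "l2 \<le> l1"
  shows "(x - y) * schur [l1, l2] [x, y] = x ^ Suc l1 * y ^ l2 - x ^ l2 * y ^ Suc l1"
proof -
  have "(x - y) * (\<Sum>i\<in>{l2..l2 + n}. x ^ i * y ^ (l2 + n + l2 - i)) = x ^ Suc (l2 + n) * y ^ l2 - x ^ l2 * y ^ Suc (l2 + n)" for n
  proof (induction n)
    case 0
    show ?case by (simp add: algebra_simps)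
  next
    case (Suc n)
    have "(\<Sum>i\<in>{l2..l2 + Suc n}. x ^ i * y ^ (l2 + Suc n + l2 - i)) =
        y * (\<Sum>i\<in>{l2..l2 + n}. x ^ i * y ^ (l2 + n + l2 - i)) + x ^ (l2 + Suc n) * y ^ l2"
    proof -
      have "x ^ i * y ^ (l2 + Suc n + l2 - i) = y * (x ^ i * y ^ (l2 + n + l2 - i))" if "i \<in> {l2..l2 + n}" for i
      proof -
        have "l2 + Suc n + l2 - i = Suc (l2 + n + l2 - i)" using that by auto
        then show ?thesis by (simp add: mult.left_commute)
      qed
      then show ?thesis by (simp add: sum_distrib_left)
    qed
    then have "(x - y) * (\<Sum>i\<in>{l2..l2 + Suc n}. x ^ i * y ^ (l2 + Suc n + l2 - i)) =
        y * ((x - y) * (\<Sum>i\<in>{l2..l2 + n}. x ^ i * y ^ (l2 + n + l2 - i))) + (x - y) * (x ^ (l2 + Suc n) * y ^ l2)"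
      by (simp only: distrib_left mult.left_commute)
    then show ?case unfolding Suc.IH by (simp add: algebra_simps)
  qed
  from this[of "l1 - l2"] show ?thesis using assms by (simp add: schur_two_rows)
qed

section \<open>The numerator\<close>

text \<open>
  Apart from the sign, the coefficient of the elementary symmetric polynomial of degree \<open>m\<close> in
  \<open>(x - y) ^ 3\<close> times the K-polynomial.
\<close>

definition tail_numerator :: "'a::comm_ring_1 \<Rightarrow> 'a \<Rightarrow> nat \<Rightarrow> 'a" where
  "tail_numerator x y m = x\<^sup>2 * y ^ m * (x - 3 * y - of_nat m * (x - y)) - y\<^sup>2 * x ^ m * (y - 3 * x - of_nat m * (y - x))"

text \<open>
  The sum of \<open>s_\<lambda>(1, 1) s_\<lambda>(x, y)\<close> over the partitions \<open>\<lambda>\<close> of \<open>m\<close> into two parts that are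
  both at least two.
\<close>

definition schur_tail :: "'a::comm_ring_1 \<Rightarrow> 'a \<Rightarrow> nat \<Rightarrow> 'a" where
  "schur_tail x y m = (\<Sum>k\<in>{2..m div 2}. of_nat (m - 2 * k + 1) * schur [m - k, k] [x, y])"

text \<open>
  Adding a column of length two to the diagram of \<open>\<lambda>\<close> does not change \<open>s_\<lambda>(1, 1)\<close> and multiplies \<open>s_\<lambda>(x, y)\<close> by
  \<open>x * y\<close>. This reaches all partitions of \<open>m + 2\<close> except the one with second part equal to two.
\<close>

lemma schur_tail_step:
  fixes x y :: "'a::comm_ring_1"
  assumes "1 \<le> m div 2"
  shows "(x - y) * schur_tail x y (m + 2) = x * y * ((x - y) * schur_tail x y m) +
     of_nat (m - 1) * (x ^ Suc m * y\<^sup>2 - x\<^sup>2 * y ^ Suc m)"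
proof -
  let ?f = "\<lambda>m k. of_nat (m - 2 * k + 1) * (x ^ Suc (m - k) * y ^ k - x ^ k * y ^ Suc (m - k)) :: 'a"
  have tail: "(x - y) * schur_tail x y m = (\<Sum>k\<in>{2..m div 2}. ?f m k)" for m
    unfolding schur_tail_def sum_distrib_left
  proof (intro sum.cong refl)
    fix k assume "k \<in> {2..m div 2}"
    then have "k \<le> m - k" by auto
    show "(x - y) * (of_nat (m - 2 * k + 1) * schur [m - k, k] [x, y]) = ?f m k"
      unfolding schur_two_rows_antisymmetric[OF \<open>k \<le> m - k\<close>, symmetric] by (rule mult.left_commute)
  qed
  have "(\<Sum>k\<in>{2..Suc (m div 2)}. ?f (m + 2) k) = (\<Sum>k\<in>{1..m div 2}. ?f (m + 2) (Suc k))"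
    using sum.shift_bounds_cl_Suc_ivl[of "?f (m + 2)" 1 "m div 2"] by (simp add: numeral_2_eq_2)
  also have "\<dots> = ?f (m + 2) (Suc 1) + (\<Sum>k\<in>{2..m div 2}. ?f (m + 2) (Suc k))"
    using assms by (subst sum.atLeast_Suc_atMost) (simp_all add: numeral_2_eq_2)
  also have "(\<Sum>k\<in>{2..m div 2}. ?f (m + 2) (Suc k)) = x * y * (\<Sum>k\<in>{2..m div 2}. ?f m k)"
    unfolding sum_distrib_left
  proof (intro sum.cong refl)
    fix k assume "k \<in> {2..m div 2}"
    then have "m + 2 - 2 * Suc k + 1 = m - 2 * k + 1" "Suc (m + 2 - Suc k) = Suc (Suc (m - k))" by auto
    then show "?f (m + 2) (Suc k) = x * y * ?f m k" by (simp add: algebra_simps)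
  qed
  also have "?f (m + 2) (Suc 1) = of_nat (m - 1) * (x ^ Suc m * y\<^sup>2 - x\<^sup>2 * y ^ Suc m)"
  proof -
    have "m + 2 - 2 * Suc 1 + 1 = m - 1" "Suc (m + 2 - Suc 1) = Suc m" using assms by auto
    then show ?thesis by (simp add: power2_eq_square)
  qed
  finally show ?thesis unfolding tail by (simp add: add.commute)
qed

lemma schur_tail_numerator:
  fixes x y :: "'a::comm_ring_1"
  assumes "m \<noteq> 0"
  shows "(x - y) ^ 3 * schur_tail x y m = - tail_numerator x y m"
  using assms
proof (induction m rule: less_induct)
  case (less m)
  show ?case
  proof (cases "4 \<le> m")
    case False
    then consider "m = 1" | "m = 2" | "m = 3" using less.prems by linarith
    then show ?thesis
      by cases (simp_all add: schur_tail_def tail_numerator_def algebra_simps power2_eq_square power3_eq_cube)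
  next
    case True
    define l where "l = m - 2"
    have m: "m = l + 2" and l: "2 \<le> l" using True by (auto simp: l_def)
    have IH: "(x - y) ^ 3 * schur_tail x y l = - tail_numerator x y l"
      using l by (intro less.IH) (simp_all add: m)
    have "(x - y) ^ 3 * schur_tail x y m = (x - y)\<^sup>2 * ((x - y) * schur_tail x y (l + 2))"
      by (simp add: m power2_eq_square power3_eq_cube mult.assoc)
    also have "\<dots> = x * y * ((x - y) ^ 3 * schur_tail x y l) +
        (x - y)\<^sup>2 * (of_nat (l - 1) * (x ^ Suc l * y\<^sup>2 - x\<^sup>2 * y ^ Suc l))"
      using l by (subst schur_tail_step) (simp_all add: power2_eq_square power3_eq_cube distrib_left mult_ac)
    also have "\<dots> = - tail_numerator x y m"
      using l unfolding IH m by (simp add: tail_numerator_def of_nat_diff power2_eq_square algebra_simps)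
    finally show ?thesis .
  qed
qed

lemma euler_product_expansion:
  fixes t :: "'n::finite \<Rightarrow> 'a::comm_ring_1"
  shows "(\<Prod>j\<in>J. 1 - x * t j) = (\<Sum>S\<in>Pow J. (- x) ^ card S * prod t S)"
proof -
  have "(\<Prod>j\<in>J. (- x * t j) + 1) = (\<Sum>S\<in>Pow J. (\<Prod>j\<in>S. - x * t j) * (\<Prod>j\<in>J - S. 1))"
    by (rule prod_add) simp
  moreover have "(\<Prod>j\<in>J. (- x * t j) + 1) = (\<Prod>j\<in>J. 1 - x * t j)" by simp
  ultimately show ?thesis by (simp only: prod.distrib prod_constant power_one mult_1_right)
qed

text \<open>
  The left side is \<open>- x\<close> times the derivative of the Euler product with respect to \<open>x\<close>, so that
  each term of degree \<open>m\<close> in \<open>x\<close> is multiplied by \<open>- m\<close>.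
\<close>

lemma euler_product_derivative:
  fixes t :: "'n::finite \<Rightarrow> 'a::comm_ring_1"
  shows "(\<Sum>j\<in>UNIV. x * t j * (\<Prod>l\<in>UNIV - {j}. 1 - x * t l)) = - (\<Sum>S\<in>UNIV. of_nat (card S) * ((- x) ^ card S * prod t S))"
proof -
  have "x * t j * (\<Prod>l\<in>UNIV - {j}. 1 - x * t l) = (\<Sum>S | j \<in> S. - ((- x) ^ card S * prod t S))" for j
  proof -
    have "(\<Sum>S\<in>Pow (UNIV - {j}). - ((- x) ^ card (insert j S) * prod t (insert j S))) =
        (\<Sum>S | j \<in> S. - ((- x) ^ card S * prod t S))"
      by (rule sum.reindex_bij_witness[of _ "\<lambda>S. S - {j}" "insert j"]) auto
    moreover have "- ((- x) ^ card (insert j S) * prod t (insert j S)) = x * t j * ((- x) ^ card S * prod t S)"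
      if "S \<in> Pow (UNIV - {j})" for S
    proof -
      have "j \<notin> S" using that by auto
      then show ?thesis by simp
    qed
    ultimately show ?thesis unfolding euler_product_expansion sum_distrib_left by simp
  qed
  then have "(\<Sum>j\<in>UNIV. x * t j * (\<Prod>l\<in>UNIV - {j}. 1 - x * t l)) =
      (\<Sum>j\<in>UNIV. \<Sum>S | S \<in> UNIV \<and> j \<in> S. - ((- x) ^ card S * prod t S))" by simp
  also have "\<dots> = (\<Sum>S\<in>UNIV. \<Sum>j | j \<in> UNIV \<and> j \<in> S. - ((- x) ^ card S * prod t S))"
    by (rule sum.swap_restrict) auto
  also have "\<dots> = (\<Sum>S\<in>UNIV. - (of_nat (card S) * ((- x) ^ card S * prod t S)))" by simp
  finally show ?thesis by (simp add: sum_negf)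
qed

lemma sum_by_cardinality:
  fixes t :: "'n::finite \<Rightarrow> 'a::comm_ring_1"
  shows "(\<Sum>S\<in>UNIV. f (card S) * prod t S) = (\<Sum>m\<le>CARD('n). f m * elem_sym m t)"
proof -
  have "(\<Sum>m\<le>CARD('n). \<Sum>S | S \<in> UNIV \<and> card S = m. f (card S) * prod t S) = (\<Sum>S\<in>UNIV. f (card S) * prod t S)"
    by (rule sum.group) (auto intro: card_mono)
  then show ?thesis by (simp add: elem_sym_def sum_distrib_left)
qed

text \<open>
  The claimed K-polynomial, over an arbitrary commutative ring.
\<close>

definition schur_K :: "('n::finite \<Rightarrow> 'a::comm_ring_1) \<Rightarrow> 'a \<Rightarrow> 'a \<Rightarrow> 'a" where
  "schur_K t x y = 1 - (\<Sum>(l1, l2) \<in> {(l1, l2). l2 \<le> l1 \<and> 2 \<le> l2 \<and> l1 + l2 \<le> CARD('n)}.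
     (- 1) ^ (l1 + l2) * schur [l1, l2] [1, 1] * schur [l1, l2] [x, y] * elem_sym (l1 + l2) t)"

lemma schur_K_subsets:
  fixes t :: "'n::finite \<Rightarrow> 'a::comm_ring_1"
  shows "schur_K t x y = (\<Sum>S\<in>UNIV. (- 1) ^ card S * (of_bool (card S = 0) - schur_tail x y (card S)) * prod t S)"
proof -
  let ?\<Lambda> = "{(l1, l2). l2 \<le> l1 \<and> 2 \<le> l2 \<and> l1 + l2 \<le> CARD('n)}"
  let ?F = "\<lambda>l1 l2. (- 1) ^ (l1 + l2) * schur [l1, l2] [1, 1] * schur [l1, l2] [x, y] * elem_sym (l1 + l2) t"
  have "(\<Sum>(l1, l2)\<in>?\<Lambda>. ?F l1 l2) = (\<Sum>(m, k)\<in>Sigma {..CARD('n)} (\<lambda>m. {2..m div 2}). ?F (m - k) k)"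
    by (rule sum.reindex_bij_witness[of _ "\<lambda>(m, k). (m - k, k)" "\<lambda>(l1, l2). (l1 + l2, l2)"]) auto
  also have "\<dots> = (\<Sum>m\<le>CARD('n). \<Sum>k\<in>{2..m div 2}. ?F (m - k) k)"
    by (rule sum.Sigma[symmetric]) auto
  also have "\<dots> = (\<Sum>m\<le>CARD('n). (- 1) ^ m * schur_tail x y m * elem_sym m t)"
  proof (intro sum.cong refl)
    fix m
    have "?F (m - k) k = (- 1) ^ m * (of_nat (m - 2 * k + 1) * schur [m - k, k] [x, y]) * elem_sym m t"
      if "k \<in> {2..m div 2}" for k
    proof -
      have "k \<le> m - k" "m - k + k = m" "m - k - k = m - 2 * k" using that by auto
      then show ?thesis by (simp add: schur_two_rows_at_ones mult.assoc)
    qed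
    then show "(\<Sum>k\<in>{2..m div 2}. ?F (m - k) k) = (- 1) ^ m * schur_tail x y m * elem_sym m t"
      unfolding schur_tail_def sum_distrib_left sum_distrib_right by (intro sum.cong refl) blast
  qed
  also have "\<dots> = (\<Sum>S\<in>UNIV. (- 1) ^ card S * schur_tail x y (card S) * prod t S)"
    by (rule sum_by_cardinality[symmetric])
  finally have tail: "(\<Sum>(l1, l2)\<in>?\<Lambda>. ?F l1 l2) = (\<Sum>S\<in>UNIV. (- 1) ^ card S * schur_tail x y (card S) * prod t S)" .
  have one: "(1 :: 'a) = (\<Sum>S\<in>UNIV. (- 1) ^ card S * of_bool (card S = 0) * prod t S)"
  proof -
    have "(\<Sum>S\<in>UNIV. (- 1) ^ card S * of_bool (card S = 0) * prod t S) = (\<Sum>S\<in>{{}}. (- 1) ^ card S * of_bool (card S = 0) * prod t S)"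
      by (rule sum.mono_neutral_right) auto
    then show ?thesis by simp
  qed
  show ?thesis
    unfolding schur_K_def tail by (subst one) (simp add: algebra_simps sum_subtractf)
qed

text \<open>
  Both sides are sums over sets \<open>S\<close> of columns, and agree in each of them by
  \<open>schur_tail_numerator\<close>. The right side has the form in which the geometric products, multiplied by
  the Euler products, yield it.
\<close>

lemma schur_K_numerator:
  fixes t :: "'n::finite \<Rightarrow> 'a::comm_ring_1"
  shows "(x - y) ^ 3 * schur_K t x y =
    x * x * (x - 3 * y) * (\<Prod>j\<in>UNIV. 1 - y * t j)
    + x * x * (x - y) * (\<Sum>j\<in>UNIV. y * t j * (\<Prod>l\<in>UNIV - {j}. 1 - y * t l))
    - y * y * (y - 3 * x) * (\<Prod>j\<in>UNIV. 1 - x * t j)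
    - y * y * (y - x) * (\<Sum>j\<in>UNIV. x * t j * (\<Prod>l\<in>UNIV - {j}. 1 - x * t l))"
proof -
  have num: "(x - y) ^ 3 * (of_bool (m = 0) - schur_tail x y m) = tail_numerator x y m" for m
  proof (cases "m = 0")
    case True
    then show ?thesis
      by (simp add: schur_tail_def tail_numerator_def power3_eq_cube power2_eq_square algebra_simps)
  next
    case False
    then show ?thesis using schur_tail_numerator[OF False, of x y] by (simp add: algebra_simps)
  qed
  have minus: "(- z) ^ m = (- 1) ^ m * z ^ m" for z :: 'a and m
    by (rule power_minus)
  have expand: "s * (x\<^sup>2 * Y * (x - 3 * y - c * (x - y)) - y\<^sup>2 * X * (y - 3 * x - c * (y - x))) * T =
      x * x * (x - 3 * y) * (s * Y * T) + x * x * (x - y) * - (c * (s * Y * T))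
      - y * y * (y - 3 * x) * (s * X * T) - y * y * (y - x) * - (c * (s * X * T))" for s X Y c T :: 'a
    by (simp add: power2_eq_square algebra_simps)
  have "(x - y) ^ 3 * schur_K t x y = (\<Sum>S\<in>UNIV. (- 1) ^ card S * tail_numerator x y (card S) * prod t S)"
    unfolding schur_K_subsets sum_distrib_left num[symmetric] by (intro sum.cong refl) (simp only: mult_ac)
  also have "\<dots> = x * x * (x - 3 * y) * (\<Sum>S\<in>UNIV. (- y) ^ card S * prod t S)
    + x * x * (x - y) * (- (\<Sum>S\<in>UNIV. of_nat (card S) * ((- y) ^ card S * prod t S)))
    - y * y * (y - 3 * x) * (\<Sum>S\<in>UNIV. (- x) ^ card S * prod t S)
    - y * y * (y - x) * (- (\<Sum>S\<in>UNIV. of_nat (card S) * ((- x) ^ card S * prod t S)))"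
    unfolding sum_distrib_left sum_negf[symmetric] sum.distrib[symmetric] sum_subtractf[symmetric]
    unfolding minus[of x] minus[of y] tail_numerator_def expand ..
  finally show ?thesis
    unfolding euler_product_derivative unfolding euler_product_expansion by simp
qed

section \<open>The K-polynomial\<close>

lemma orbit_series_bounded: "bounded_second orbit_series"
  unfolding bounded_second_def
  by (intro exI[of _ 0] allI impI) (simp add: orbit_series_eq)

lemma euler_product_times_geometric_product:
  fixes P :: "(2, 'n::finite) laurent"
  assumes "i \<noteq> i'"
  shows "(\<Prod>j\<in>UNIV. 1 - u_var i' * t_var j) \<star> (P \<star> geometric_product i UNIV) = Poly_Mapping.lookup P"
  using euler_product_times_full_geometric_product[OF assms, where ?'n = 'n] series_mult_lookup[of P 1]
  by (simp add: series_mult_commute[of _ P])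

lemma euler_products_times_weighted_geometric_product:
  fixes P :: "(2, 'n::finite) laurent"
  assumes "i \<noteq> i'"
  shows "(\<Prod>j\<in>UNIV. 1 - u_var i' * t_var j) \<star> ((\<Prod>j\<in>UNIV. 1 - u_var i * t_var j) \<star> (P \<star> (\<lambda>d. \<Sum>j\<in>UNIV. weighted_geometric_product i j d)))
    = Poly_Mapping.lookup (P * (\<Sum>j\<in>UNIV. u_var i * t_var j * (\<Prod>l\<in>UNIV - {j}. 1 - u_var i * t_var l)))"
proof -
  define E where "E i = (\<Prod>j\<in>UNIV. 1 - u_var i * t_var j :: (2, 'n) laurent)" for i
  define W where "W j = u_var i * t_var j * (\<Prod>l\<in>UNIV - {j}. 1 - u_var i * t_var l :: (2, 'n) laurent)" for j
  have "E i \<star> weighted_geometric_product i j = W j \<star> geometric_product i UNIV" for j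
  proof -
    have "E i = (\<Prod>l\<in>UNIV - {j}. 1 - u_var i * t_var l) * (1 - u_var i * t_var j)"
      unfolding E_def by (subst prod.remove[of UNIV j]) (simp_all add: mult.commute)
    then have "E i \<star> weighted_geometric_product i j = (\<Prod>l\<in>UNIV - {j}. 1 - u_var i * t_var l) \<star> ((u_var i * t_var j) \<star> geometric_product i UNIV)"
      by (simp only: series_mult_mult[of _ "1 - _"] weighted_geometric_product_step)
    then show ?thesis unfolding W_def by (simp only: series_mult_mult[symmetric] mult.commute)
  qed
  then have rows: "E i \<star> (\<lambda>d. \<Sum>j\<in>UNIV. weighted_geometric_product i j d) = (\<lambda>d. \<Sum>j\<in>UNIV. (W j \<star> geometric_product i UNIV) d)"
    by (simp only: series_mult_sum_right)
  have "E i' \<star> (E i \<star> (P \<star> (\<lambda>d. \<Sum>j\<in>UNIV. weighted_geometric_product i j d))) =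
      P \<star> (E i' \<star> (\<lambda>d. \<Sum>j\<in>UNIV. (W j \<star> geometric_product i UNIV) d))"
    unfolding series_mult_commute[of _ P] rows ..
  also have "\<dots> = P \<star> (\<lambda>d. \<Sum>j\<in>UNIV. Poly_Mapping.lookup (W j) d)"
    unfolding series_mult_sum_right E_def euler_product_times_geometric_product[OF assms] ..
  also have "\<dots> = Poly_Mapping.lookup (P * (\<Sum>j\<in>UNIV. W j))"
    unfolding series_mult_lookup[symmetric] by (simp add: lookup_sum[abs_def])
  finally show ?thesis unfolding E_def W_def .
qed

text \<open>
  After multiplication by the third power of \<open>u_var 1 - u_var 2\<close> both sides are known as Laurent
  polynomials and agree; both are bounded, so this factor can be cancelled.
\<close>

theorem euler_products_times_orbit_series:
  "((\<Prod>j\<in>UNIV. 1 - u_var 1 * t_var j) * (\<Prod>j\<in>UNIV. 1 - u_var 2 * t_var j)) \<star> orbit_series =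
     Poly_Mapping.lookup (schur_K t_var (u_var 1) (u_var 2) :: (2, 'n::finite) laurent)"
proof -
  define E1 E2 :: "(2, 'n) laurent"
    where "E1 = (\<Prod>j\<in>UNIV. 1 - u_var 1 * t_var j)" and "E2 = (\<Prod>j\<in>UNIV. 1 - u_var 2 * t_var j)"
  define K :: "(2, 'n) laurent" where "K = schur_K t_var (u_var 1) (u_var 2)"
  let ?D = "u_diff :: (2, 'n) laurent"
  define F where "F = (\<lambda>d. ((E1 * E2) \<star> orbit_series) d - Poly_Mapping.lookup K d)"
  have p2: "(E1 * E2) \<star> (P \<star> geometric_product 2 UNIV) = Poly_Mapping.lookup (P * E2)" for P
    using euler_product_times_geometric_product[of 2 1 "P * E2"]
    by (simp add: E1_def[symmetric] series_mult_mult series_mult_commute[of E2])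
  have p1: "(E1 * E2) \<star> (P \<star> geometric_product 1 UNIV) = Poly_Mapping.lookup (P * E1)" for P
    using euler_product_times_geometric_product[of 1 2 "P * E1"]
    by (simp add: E2_def[symmetric] series_mult_mult series_mult_commute[of E1])
  have r2: "(E1 * E2) \<star> (P \<star> (\<lambda>d. \<Sum>j\<in>UNIV. weighted_geometric_product 2 j d)) =
      Poly_Mapping.lookup (P * (\<Sum>j\<in>UNIV. u_var 2 * t_var j * (\<Prod>l\<in>UNIV - {j}. 1 - u_var 2 * t_var l)))" for P
    using euler_products_times_weighted_geometric_product[of 2 1 P] by (simp add: E1_def E2_def series_mult_mult)
  have r1: "(E1 * E2) \<star> (P \<star> (\<lambda>d. \<Sum>j\<in>UNIV. weighted_geometric_product 1 j d)) =
      Poly_Mapping.lookup (P * (\<Sum>j\<in>UNIV. u_var 1 * t_var j * (\<Prod>l\<in>UNIV - {j}. 1 - u_var 1 * t_var l)))" for P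
    using euler_products_times_weighted_geometric_product[of 1 2 P]
    by (simp add: E1_def E2_def series_mult_mult series_mult_commute)
  have "(E1 * E2) \<star> (?D \<star> (?D \<star> (?D \<star> orbit_series))) = Poly_Mapping.lookup (?D ^ 3 * K)"
    unfolding orbit_series_closed_form series_mult_add_right series_mult_diff_right p1 p2 r1 r2
    unfolding K_def schur_K_numerator E1_def E2_def
    by (simp only: lookup_add lookup_minus fun_eq_iff) simp
  then have "?D \<star> (?D \<star> (?D \<star> ((E1 * E2) \<star> orbit_series))) = ?D \<star> (?D \<star> (?D \<star> Poly_Mapping.lookup K))"
    by (simp only: series_mult_commute[of "E1 * E2"] series_mult_lookup power3_eq_cube mult.assoc)
  then have zero: "?D \<star> (?D \<star> (?D \<star> F)) = (\<lambda>d. 0)"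
    unfolding F_def series_mult_diff_right by simp
  have F: "bounded_second F"
    unfolding F_def by (intro bounded_second_diff bounded_second_series_mult orbit_series_bounded bounded_second_lookup)
  note DF = bounded_second_series_mult[OF F, of ?D]
  have "?D \<star> (?D \<star> F) = (\<lambda>d. 0)" by (rule u_diff_cancel[OF bounded_second_series_mult[OF DF] zero])
  then have "?D \<star> F = (\<lambda>d. 0)" by (rule u_diff_cancel[OF DF])
  then have "F = (\<lambda>d. 0)" by (rule u_diff_cancel[OF F])
  then show ?thesis by (simp add: F_def fun_eq_iff E1_def E2_def K_def)
qed

theorem proposition5p2:
  fixes v :: "('k::{alg_closed_field, field_char_0})^'n::finite^2"
  assumes "uniform_rank2 v"
  shows "K_polynomial_variety (matrix_orbit_closure v) =
    1 - (\<Sum>(l1, l2) \<in> {(l1, l2). l2 \<le> l1 \<and> 2 \<le> l2 \<and> l1 + l2 \<le> CARD('n)}.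
           (- 1) ^ (l1 + l2) * schur [l1, l2] [1, 1] * schur [l1, l2] [u_var 1, u_var 2]
             * elem_sym (l1 + l2) t_var)"
proof -
  let ?K = "schur_K t_var (u_var 1) (u_var 2) :: (2, 'n) laurent"
  have H: "(\<lambda>d. int (hilbert_function (vanishing_ideal (matrix_orbit_closure v)) d)) = orbit_series"
    by (simp add: fun_eq_iff orbit_series_def hilbert_function_orbit_closure[OF assms])
  have E: "(\<Prod>i\<in>UNIV. \<Prod>j\<in>UNIV. 1 - u_var i * t_var j :: (2, 'n) laurent) =
      (\<Prod>j\<in>UNIV. 1 - u_var 1 * t_var j) * (\<Prod>j\<in>UNIV. 1 - u_var 2 * t_var j)"
    by (simp add: UNIV_2)
  have "K_polynomial_variety (matrix_orbit_closure v) = ?K"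
    unfolding K_polynomial_variety_def K_polynomial_def H E euler_products_times_orbit_series
    by (rule the_equality) (auto intro: poly_mapping_eqI)
  then show ?thesis unfolding schur_K_def .
qed

end
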